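(* Let $n\ge3$, $\delta>0$, $0\le\theta\le2$, $\mu>0$, $\kappa>0$. There is a constant $C>0$, independent of $t$ and of the data, such that for all $u_0\in L^2(\mathbf{R}^n)$ and $u_1\in L^1(\mathbf{R}^n)\cap L^2(\mathbf{R}^n)$, $$\|u(t,\cdot)\|^2=\|w(t,\cdot)\|^2\le C\left(\|u_0\|^2+\|u_1\|^2+\|u_1\|_1^2\right)\qquad\text{for all sufficiently large } t,$$ where $u(t,\cdot)$ is the solution of $$u_{tt}+\delta(-\Delta)^\theta u_{tt}+\mu\Delta^2u-\kappa\Delta u=0\ \text{ in }(0,\infty)\times\mathbf{R}^n,\qquad u(0,\cdot)=u_0,\ u_t(0,\cdot)=u_1,$$ and $w(t,\cdot)=\hat u(t,\cdot)$ is its spatial Fourier transform.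
   Context: The Fourier transform is $\hat g(\xi)=\int_{\mathbf{R}^n}e^{-ix\cdot\xi}g(x)\,dx$. $\|\cdot\|$ is the $L^2(\mathbf{R}^n)$ norm and $\|\cdot\|_1$ the $L^1(\mathbf{R}^n)$ norm; for functions of the frequency variable $\xi$, the $L^2$ norm is taken with respect to the measure $(2\pi)^{-n}d\xi$, so that Plancherel's identity reads $\|\hat g\|=\|g\|$. The solution is understood through the Fourier representation: $u(t,\cdot)=\mathcal{F}^{-1}(w(t,\cdot))$, where $$w(t,\xi)=\cos(tf(|\xi|))\hat u_0(\xi)+\frac{\sin(tf(|\xi|))}{f(|\xi|)}\hat u_1(\xi),\qquad f(r)=\sqrt{\frac{\mu r^4+\kappa r^2}{1+\delta r^{2\theta}}}.$$ *)

theory Defs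
  imports "HOL-Analysis.Analysis"
begin

text \<open>
  Functions stand for their classes modulo null sets. Data are complex valued, which includes
  the real valued case.
\<close>

definition L1 :: "'a measure \<Rightarrow> ('a \<Rightarrow> complex) set" where
  "L1 M = {g. integrable M g}"

definition L1_norm :: "'a measure \<Rightarrow> ('a \<Rightarrow> complex) \<Rightarrow> real" where
  "L1_norm M g = (LINT x|M. cmod (g x))"

definition L2 :: "'a measure \<Rightarrow> ('a \<Rightarrow> complex) set" where
  "L2 M = {g \<in> borel_measurable M. integrable M (\<lambda>x. (cmod (g x))\<^sup>2)}"

definition L2_norm :: "'a measure \<Rightarrow> ('a \<Rightarrow> complex) \<Rightarrow> real" where
  "L2_norm M g = sqrt (LINT x|M. (cmod (g x))\<^sup>2)"

text \<open>The measure \<open>(2\<pi>)\<close> to the power \<open>-n\<close> times \<open>d\<xi>\<close> on frequency space.\<close>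

definition freq_measure :: "(real ^ 'n) measure" where
  "freq_measure = density lebesgue (\<lambda>_. ennreal (1 / (2 * pi) ^ CARD('n)))"

definition fourier_integral :: "(real ^ 'n \<Rightarrow> complex) \<Rightarrow> real ^ 'n \<Rightarrow> complex" where
  "fourier_integral g \<xi> = (LINT x|lebesgue. exp (- (\<i> * complex_of_real (x \<bullet> \<xi>))) * g x)"

text \<open>
  For \<open>g\<close> in L2 the integral above need not converge. As usual, the Fourier transform of \<open>g\<close> is
  then the L2 limit of the Fourier integrals of the truncations of \<open>g\<close> to balls, which lie in
  both L1 and L2. For \<open>g\<close> in both L1 and L2 this limit is \<open>fourier_integral g\<close> almost everywhere.
  The squared L2 distance is written as a nonnegative integral, so that its tending to 0
  includes its finiteness.
\<close>

definition has_fourier_transform :: "(real ^ 'n \<Rightarrow> complex) \<Rightarrow> (real ^ 'n \<Rightarrow> complex) \<Rightarrow> bool" where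
  "has_fourier_transform g G \<longleftrightarrow>
     g \<in> L2 lebesgue \<and> G \<in> L2 freq_measure \<and>
     ((\<lambda>R::real. \<integral>\<^sup>+ \<xi>. ennreal ((cmod
          (fourier_integral (\<lambda>x. indicator (ball 0 R) x * g x) \<xi> - G \<xi>))\<^sup>2) \<partial>freq_measure)
        \<longlongrightarrow> 0) at_top"

text \<open>Both operators are determined up to null sets only, hence the choice of a representative.\<close>

definition fourier :: "(real ^ 'n \<Rightarrow> complex) \<Rightarrow> real ^ 'n \<Rightarrow> complex" where
  "fourier g = (SOME G. has_fourier_transform g G)"

definition inv_fourier :: "(real ^ 'n \<Rightarrow> complex) \<Rightarrow> real ^ 'n \<Rightarrow> complex" where
  "inv_fourier G = (SOME g. has_fourier_transform g G)"

definition symbol :: "real \<Rightarrow> real \<Rightarrow> real \<Rightarrow> real \<Rightarrow> real \<Rightarrow> real" where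
  "symbol \<delta> \<theta> \<mu> \<kappa> r = sqrt ((\<mu> * r ^ 4 + \<kappa> * r\<^sup>2) / (1 + \<delta> * r powr (2 * \<theta>)))"

text \<open>
  The solution of \<open>u\<^sub>t\<^sub>t + \<delta> (-\<Delta>)\<^sup>\<theta> u\<^sub>t\<^sub>t + \<mu> \<Delta>\<^sup>2 u - \<kappa> \<Delta> u = 0\<close>, \<open>u(0) = u0\<close>, \<open>u\<^sub>t(0) = u1\<close>, is given through its
  Fourier representation. The values at \<open>\<xi> = 0\<close>, where the symbol vanishes (so that the quotient
  is 0 instead of \<open>t\<close>) and where \<open>0 powr 0 = 0\<close>, concern only a null set.
\<close>

definition solution_hat :: "real \<Rightarrow> real \<Rightarrow> real \<Rightarrow> real \<Rightarrow> (real ^ 'n \<Rightarrow> complex) \<Rightarrow>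
    (real ^ 'n \<Rightarrow> complex) \<Rightarrow> real \<Rightarrow> real ^ 'n \<Rightarrow> complex" where
  "solution_hat \<delta> \<theta> \<mu> \<kappa> u0 u1 t \<xi> =
     (let f = symbol \<delta> \<theta> \<mu> \<kappa> (norm \<xi>) in
        complex_of_real (cos (t * f)) * fourier u0 \<xi> +
        complex_of_real (sin (t * f) / f) * fourier u1 \<xi>)"

definition solution :: "real \<Rightarrow> real \<Rightarrow> real \<Rightarrow> real \<Rightarrow> (real ^ 'n \<Rightarrow> complex) \<Rightarrow>
    (real ^ 'n \<Rightarrow> complex) \<Rightarrow> real \<Rightarrow> real ^ 'n \<Rightarrow> complex" where
  "solution \<delta> \<theta> \<mu> \<kappa> u0 u1 t = inv_fourier (solution_hat \<delta> \<theta> \<mu> \<kappa> u0 u1 t)"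

end

(* The bound: |sin (t f) / f|^2 is at most 1 / f^2, which is O(1 / |xi|^2) for |xi| < 1 and O(1) for
   |xi| >= 1. In dimension n >= 3 the function 1 / |xi|^2 is integrable on the unit ball, so the low
   frequencies of u1 are controlled by the supremum of its transform, hence by its L1 norm, and the
   high ones by its L2 norm.

   Plancherel's theorem: for bounded continuous g in L1, Fubini's theorem rewrites the integral of
   |g^|^2 against a Gaussian as an average of g against its translates, and letting the Gaussian tend
   to 1 gives the identity. Density carries it to the intersection of L1 and L2, and completeness of
   L2 to truncation limits. *)

theory Submission
  imports Defs "HOL-Probability.Characteristic_Functions"
begin

section \<open>The Hilbert space L2\<close>

text \<open>\<open>solution\<close> is a chosen preimage of \<open>solution_hat\<close>, so
  comparing their norms requires that every L2 function of frequency be a Fourier transform.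
  Surjectivity of the transform is therefore proved along with Plancherel's identity, without an
  inversion formula. The Gaussian weight answers a convergence problem: for integrable g the
  transform is only known to be bounded, so the integral of its squared modulus cannot be unfolded
  by Fubini directly. The weight makes everything absolutely convergent, and since its own transform
  is again Gaussian, it reappears in space as an approximate identity. All estimates are carried out
  for Lebesgue measure, where the transform multiplies norms by the square root of (2 pi)^n; the
  normalisation of \<open>freq_measure\<close> is restored only in comparisons with it.\<close>

lemma L2_iff:
  "f \<in> L2 M \<longleftrightarrow> f \<in> borel_measurable M \<and> (\<integral>\<^sup>+x. ennreal ((cmod (f x))\<^sup>2) \<partial>M) < \<infinity>"
  unfolding L2_def by (auto simp: integrable_iff_bounded)

lemma L2_measurable: "f \<in> L2 M \<Longrightarrow> f \<in> borel_measurable M"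
  by (simp add: L2_def)

lemma L2_integrable: "f \<in> L2 M \<Longrightarrow> integrable M (\<lambda>x. (cmod (f x))\<^sup>2)"
  by (simp add: L2_def)

lemma L2_norm_nonneg [simp]: "0 \<le> L2_norm M f"
  by (simp add: L2_norm_def)

lemma L2_norm_power2: "(L2_norm M f)\<^sup>2 = (LINT x|M. (cmod (f x))\<^sup>2)"
  by (simp add: L2_norm_def)

lemma nn_integral_L2:
  "f \<in> L2 M \<Longrightarrow> (\<integral>\<^sup>+x. ennreal ((cmod (f x))\<^sup>2) \<partial>M) = ennreal ((L2_norm M f)\<^sup>2)"
  unfolding L2_norm_power2 by (intro nn_integral_eq_integral L2_integrable) auto

text \<open>Domination up to a constant factor is the common route to square integrability of
  conjugates, multiples, truncations and Fourier multipliers.\<close>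

lemma L2_bounded:
  assumes f: "f \<in> L2 M" and g: "g \<in> borel_measurable M"
    and le: "AE x in M. cmod (g x) \<le> B * cmod (f x)"
  shows "g \<in> L2 M"
proof -
  have "integrable M (\<lambda>x. B\<^sup>2 * (cmod (f x))\<^sup>2)"
    using L2_integrable[OF f] by simp
  moreover have "AE x in M. norm ((cmod (g x))\<^sup>2) \<le> norm (B\<^sup>2 * (cmod (f x))\<^sup>2)"
    using le by eventually_elim
      (auto simp: power_mult_distrib[symmetric] intro!: power_mono)
  moreover have "(\<lambda>x. (cmod (g x))\<^sup>2) \<in> borel_measurable M"
    using g by measurable
  ultimately have "integrable M (\<lambda>x. (cmod (g x))\<^sup>2)"
    by (metis (no_types) Bochner_Integration.integrable_bound)
  with g show ?thesis by (simp add: L2_def)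
qed

lemma L2_norm_mono:
  assumes f: "f \<in> L2 M" and g: "g \<in> borel_measurable M"
    and le: "AE x in M. cmod (g x) \<le> cmod (f x)"
  shows "L2_norm M g \<le> L2_norm M f"
proof -
  have "g \<in> L2 M"
    using L2_bounded[OF f g, of 1] le by simp
  then show ?thesis
    using le unfolding L2_norm_def
    by (intro real_sqrt_le_mono integral_mono_AE L2_integrable f)
      (auto intro!: power_mono elim!: eventually_mono)
qed

lemma L2_add:
  assumes f: "f \<in> L2 M" and g: "g \<in> L2 M"
  shows "(\<lambda>x. f x + g x) \<in> L2 M"
proof -
  have [measurable]: "f \<in> borel_measurable M" "g \<in> borel_measurable M"
    using f g by (auto intro: L2_measurable)
  have "(cmod (f x + g x))\<^sup>2 \<le> 2 * (cmod (f x))\<^sup>2 + 2 * (cmod (g x))\<^sup>2" for x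
  proof -
    have "(cmod (f x + g x))\<^sup>2 \<le> (cmod (f x) + cmod (g x))\<^sup>2"
      by (intro power_mono norm_triangle_ineq) auto
    also have "\<dots> \<le> 2 * (cmod (f x))\<^sup>2 + 2 * (cmod (g x))\<^sup>2"
      using sum_squares_bound[of "cmod (f x)" "cmod (g x)"] by (simp add: power2_sum)
    finally show ?thesis .
  qed
  moreover have "integrable M (\<lambda>x. 2 * (cmod (f x))\<^sup>2 + 2 * (cmod (g x))\<^sup>2)"
    using L2_integrable[OF f] L2_integrable[OF g] by simp
  ultimately have "integrable M (\<lambda>x. (cmod (f x + g x))\<^sup>2)"
    by (elim Bochner_Integration.integrable_bound) auto
  then show ?thesis by (simp add: L2_def)
qed

lemma borel_measurable_cnj [measurable (raw)]:
  "f \<in> borel_measurable M \<Longrightarrow> (\<lambda>x. cnj (f x)) \<in> borel_measurable M"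
  by (rule measurable_compose[OF _ borel_measurable_continuous_onI]) (auto intro!: continuous_intros)

lemma L2_cnj: "f \<in> L2 M \<Longrightarrow> (\<lambda>x. cnj (f x)) \<in> L2 M"
  by (rule L2_bounded[where B=1]) (auto intro: borel_measurable_cnj L2_measurable)

lemma L2_cmult: "f \<in> L2 M \<Longrightarrow> (\<lambda>x. c * f x) \<in> L2 M"
  by (rule L2_bounded[where B="cmod c"])
    (auto simp: norm_mult intro: borel_measurable_times L2_measurable)

lemma L2_minus: "f \<in> L2 M \<Longrightarrow> (\<lambda>x. - f x) \<in> L2 M"
  using L2_cmult[of f M "-1"] by simp

lemma L2_diff: "f \<in> L2 M \<Longrightarrow> g \<in> L2 M \<Longrightarrow> (\<lambda>x. f x - g x) \<in> L2 M"
  using L2_add[of f M "\<lambda>x. - g x"] L2_minus[of g M] by simp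

lemma L2_norm_cnj: "L2_norm M (\<lambda>x. cnj (f x)) = L2_norm M f"
  by (simp add: L2_norm_def)

lemma L2_norm_cmult: "L2_norm M (\<lambda>x. c * f x) = cmod c * L2_norm M f"
  by (simp add: L2_norm_def norm_mult power_mult_distrib real_sqrt_mult)

lemma L2_norm_minus_commute: "L2_norm M (\<lambda>x. f x - g x) = L2_norm M (\<lambda>x. g x - f x)"
  by (simp add: L2_norm_def norm_minus_commute)

lemma L2_norm_cong_AE:
  assumes "f \<in> borel_measurable M" "g \<in> borel_measurable M" "AE x in M. f x = g x"
  shows "L2_norm M f = L2_norm M g"
  unfolding L2_norm_def
  by (intro arg_cong[where f=sqrt] integral_cong_AE) (use assms in auto)

lemma L2_mult_integrable:
  assumes f: "f \<in> L2 M" and g: "g \<in> L2 M"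
  shows "integrable M (\<lambda>x. f x * g x)"
proof (rule Bochner_Integration.integrable_bound)
  show "integrable M (\<lambda>x. (cmod (f x))\<^sup>2 + (cmod (g x))\<^sup>2)"
    using f g by (auto intro: L2_integrable)
  show "(\<lambda>x. f x * g x) \<in> borel_measurable M"
    using L2_measurable[OF f] L2_measurable[OF g] by measurable
  have "cmod (f x) * cmod (g x) \<le> (cmod (f x))\<^sup>2 + (cmod (g x))\<^sup>2" for x
  proof -
    have "0 \<le> cmod (f x) * cmod (g x)" by simp
    then show ?thesis
      using sum_squares_bound[of "cmod (f x)" "cmod (g x)"] by linarith
  qed
  then show "AE x in M. norm (f x * g x) \<le> norm ((cmod (f x))\<^sup>2 + (cmod (g x))\<^sup>2)"
    by (simp add: norm_mult)
qed

text \<open>The modulus stays inside the integral because the triangle inequality for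
  \<open>L2_norm\<close> needs this stronger form. The inequality itself comes from its version for
  nonnegative integrals, all of which are finite here.\<close>

lemma L2_Cauchy_Schwarz:
  assumes f: "f \<in> L2 M" and g: "g \<in> L2 M"
  shows "(LINT x|M. cmod (f x) * cmod (g x)) \<le> L2_norm M f * L2_norm M g"
proof -
  have [measurable]: "f \<in> borel_measurable M" "g \<in> borel_measurable M"
    using f g by (auto intro: L2_measurable)
  let ?I = "LINT x|M. cmod (f x) * cmod (g x)"
  have int: "integrable M (\<lambda>x. cmod (f x) * cmod (g x))"
    using integrable_norm[OF L2_mult_integrable[OF f g]] by (simp add: norm_mult)
  have I: "(\<integral>\<^sup>+x. ennreal (cmod (f x)) * ennreal (cmod (g x)) \<partial>M) = ennreal ?I"
    using nn_integral_eq_integral[OF int] by (simp add: ennreal_mult)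
  have "ennreal (?I\<^sup>2) = (\<integral>\<^sup>+x. ennreal (cmod (f x)) * ennreal (cmod (g x)) \<partial>M)\<^sup>2"
    unfolding I by (simp add: ennreal_power integral_nonneg_AE)
  also have "\<dots> \<le> (\<integral>\<^sup>+x. (ennreal (cmod (f x)))\<^sup>2 \<partial>M) * (\<integral>\<^sup>+x. (ennreal (cmod (g x)))\<^sup>2 \<partial>M)"
    by (rule Cauchy_Schwarz_nn_integral) auto
  also have "\<dots> = ennreal ((L2_norm M f)\<^sup>2 * (L2_norm M g)\<^sup>2)"
    by (simp add: ennreal_power nn_integral_L2 f g ennreal_mult)
  finally have "?I\<^sup>2 \<le> (L2_norm M f * L2_norm M g)\<^sup>2"
    by (simp add: power_mult_distrib)
  then show ?thesis
    by (rule power2_le_imp_le) simp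
qed

lemma L2_inner_le:
  assumes f: "f \<in> L2 M" and g: "g \<in> L2 M"
  shows "cmod (LINT x|M. f x * g x) \<le> L2_norm M f * L2_norm M g"
  using integral_norm_bound[of M "\<lambda>x. f x * g x"] L2_Cauchy_Schwarz[OF f g]
  by (simp add: norm_mult)

lemma L2_norm_triangle:
  assumes f: "f \<in> L2 M" and g: "g \<in> L2 M"
  shows "L2_norm M (\<lambda>x. f x + g x) \<le> L2_norm M f + L2_norm M g"
proof -
  have int: "integrable M (\<lambda>x. cmod (f x) * cmod (g x))"
    using integrable_norm[OF L2_mult_integrable[OF f g]] by (simp add: norm_mult)
  have "(L2_norm M (\<lambda>x. f x + g x))\<^sup>2
      \<le> (LINT x|M. (cmod (f x))\<^sup>2 + (cmod (g x))\<^sup>2 + 2 * (cmod (f x) * cmod (g x)))"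
    unfolding L2_norm_power2
  proof (rule integral_mono)
    fix x
    have "(cmod (f x + g x))\<^sup>2 \<le> (cmod (f x) + cmod (g x))\<^sup>2"
      by (intro power_mono norm_triangle_ineq) auto
    then show "(cmod (f x + g x))\<^sup>2 \<le> (cmod (f x))\<^sup>2 + (cmod (g x))\<^sup>2 + 2 * (cmod (f x) * cmod (g x))"
      by (simp add: power2_sum)
  qed (use f g int in \<open>auto intro!: L2_integrable L2_add\<close>)
  also have "\<dots> = (L2_norm M f)\<^sup>2 + (L2_norm M g)\<^sup>2 + 2 * (LINT x|M. cmod (f x) * cmod (g x))"
    using f g int by (simp add: L2_norm_power2 L2_integrable)
  also have "\<dots> \<le> (L2_norm M f + L2_norm M g)\<^sup>2"
    using L2_Cauchy_Schwarz[OF f g] by (simp add: power2_sum)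
  finally show ?thesis
    by (rule power2_le_imp_le) simp
qed

lemma L2_norm_diff_triangle:
  assumes "f \<in> L2 M" "g \<in> L2 M" "h \<in> L2 M"
  shows "L2_norm M (\<lambda>x. f x - h x) \<le> L2_norm M (\<lambda>x. f x - g x) + L2_norm M (\<lambda>x. g x - h x)"
  using L2_norm_triangle[OF L2_diff[OF assms(1,2)] L2_diff[OF assms(2,3)]] by simp

lemma L2_norm_reverse_triangle:
  assumes f: "f \<in> L2 M" and g: "g \<in> L2 M"
  shows "\<bar>L2_norm M f - L2_norm M g\<bar> \<le> L2_norm M (\<lambda>x. f x - g x)"
  using L2_norm_triangle[OF L2_diff[OF f g] g] L2_norm_triangle[OF L2_diff[OF g f] f]
    L2_norm_minus_commute[of M f g] by simp

section \<open>Limits and completeness in L2\<close>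

lemma L2_norm_tendsto:
  assumes f: "\<And>i. f i \<in> L2 M" and g: "g \<in> L2 M"
    and lim: "((\<lambda>i. L2_norm M (\<lambda>x. f i x - g x)) \<longlongrightarrow> 0) F"
  shows "((\<lambda>i. L2_norm M (f i)) \<longlongrightarrow> L2_norm M g) F"
proof (rule LIM_zero_cancel, rule Lim_null_comparison[OF _ lim])
  show "\<forall>\<^sub>F i in F. norm (L2_norm M (f i) - L2_norm M g) \<le> L2_norm M (\<lambda>x. f i x - g x)"
    using L2_norm_reverse_triangle[OF f g] by simp
qed

lemma L2_norm_zero_AE:
  assumes f: "f \<in> L2 M" and 0: "L2_norm M f = 0"
  shows "AE x in M. f x = 0"
proof -
  have "(LINT x|M. (cmod (f x))\<^sup>2) = 0"
    using 0 L2_norm_power2[of M f] by simp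
  then show ?thesis
    using integral_nonneg_eq_0_iff_AE[OF L2_integrable[OF f]] by simp
qed

text \<open>Joint continuity of the bilinear pairing, from the splitting a b - c d = (a - c) b + c
  (b - d). The norms of \<open>b i\<close> cause no trouble since they converge to the norm of
  \<open>d\<close>.\<close>

lemma L2_mult_tendsto:
  assumes a: "\<And>i. a i \<in> L2 M" and b: "\<And>i. b i \<in> L2 M" and c: "c \<in> L2 M" and d: "d \<in> L2 M"
    and ac: "((\<lambda>i. L2_norm M (\<lambda>x. a i x - c x)) \<longlongrightarrow> 0) F"
    and bd: "((\<lambda>i. L2_norm M (\<lambda>x. b i x - d x)) \<longlongrightarrow> 0) F"
  shows "((\<lambda>i. LINT x|M. a i x * b i x) \<longlongrightarrow> (LINT x|M. c x * d x)) F"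
proof (rule LIM_zero_cancel, rule Lim_null_comparison)
  let ?A = "\<lambda>i. L2_norm M (\<lambda>x. a i x - c x)" and ?B = "\<lambda>i. L2_norm M (\<lambda>x. b i x - d x)"
  show "((\<lambda>i. ?A i * L2_norm M (b i) + L2_norm M c * ?B i) \<longlongrightarrow> 0) F"
    using tendsto_add[OF tendsto_mult[OF ac L2_norm_tendsto[OF b d bd]]
        tendsto_mult[OF tendsto_const[of "L2_norm M c"] bd]] by simp
  show "\<forall>\<^sub>F i in F. norm ((LINT x|M. a i x * b i x) - (LINT x|M. c x * d x))
      \<le> ?A i * L2_norm M (b i) + L2_norm M c * ?B i"
  proof (rule always_eventually, rule allI)
    fix i
    have "(LINT x|M. a i x * b i x) - (LINT x|M. c x * d x)
        = (LINT x|M. (a i x - c x) * b i x + c x * (b i x - d x))"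
      by (subst Bochner_Integration.integral_diff[symmetric])
        (auto intro!: L2_mult_integrable a b c d simp: algebra_simps)
    also have "\<dots> = (LINT x|M. (a i x - c x) * b i x) + (LINT x|M. c x * (b i x - d x))"
      by (intro Bochner_Integration.integral_add L2_mult_integrable L2_diff a b c d)
    also have "norm \<dots> \<le> norm (LINT x|M. (a i x - c x) * b i x) + norm (LINT x|M. c x * (b i x - d x))"
      by (rule norm_triangle_ineq)
    also have "\<dots> \<le> ?A i * L2_norm M (b i) + L2_norm M c * ?B i"
      by (intro add_mono L2_inner_le L2_diff a b c d)
    finally show "norm ((LINT x|M. a i x * b i x) - (LINT x|M. c x * d x))
      \<le> ?A i * L2_norm M (b i) + L2_norm M c * ?B i" .
  qed
qed

text \<open>Fatou's lemma applied to squared moduli. A pointwise limit of norm-bounded functions is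
  thereby placed in L2 without prior knowledge of its integrability; completeness and the extension
  of Plancherel's identity both depend on this.\<close>

lemma L2_Fatou:
  assumes f: "\<And>k::nat. f k \<in> L2 M" and g: "g \<in> borel_measurable M"
    and lim: "AE x in M. (\<lambda>k. f k x) \<longlonglongrightarrow> g x"
    and le: "eventually (\<lambda>k. L2_norm M (f k) \<le> B) sequentially"
  shows "g \<in> L2 M" "L2_norm M g \<le> B"
proof -
  have [measurable]: "f k \<in> borel_measurable M" for k
    using f by (auto intro: L2_measurable)
  note [measurable] = g
  obtain k where "L2_norm M (f k) \<le> B"
    using eventually_happens[OF le] by auto
  then have B: "0 \<le> B"
    by (rule order_trans[OF L2_norm_nonneg])
  have "(\<integral>\<^sup>+x. ennreal ((cmod (g x))\<^sup>2) \<partial>M) = (\<integral>\<^sup>+x. liminf (\<lambda>k. ennreal ((cmod (f k x))\<^sup>2)) \<partial>M)"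
  proof (rule nn_integral_cong_AE)
    show "AE x in M. ennreal ((cmod (g x))\<^sup>2) = liminf (\<lambda>k. ennreal ((cmod (f k x))\<^sup>2))"
      using lim
    proof eventually_elim
      case (elim x)
      then have "(\<lambda>k. ennreal ((cmod (f k x))\<^sup>2)) \<longlonglongrightarrow> ennreal ((cmod (g x))\<^sup>2)"
        by (intro tendsto_intros)
      then show ?case
        by (rule lim_imp_Liminf[OF trivial_limit_sequentially, symmetric])
    qed
  qed
  also have "\<dots> \<le> liminf (\<lambda>k. \<integral>\<^sup>+x. ennreal ((cmod (f k x))\<^sup>2) \<partial>M)"
    by (rule nn_integral_liminf) measurable
  also have "\<dots> \<le> liminf (\<lambda>k. ennreal (B\<^sup>2))"
    by (rule Liminf_mono, use le in eventually_elim)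
      (auto simp: nn_integral_L2[OF f] intro!: ennreal_leI power_mono)
  finally have *: "(\<integral>\<^sup>+x. ennreal ((cmod (g x))\<^sup>2) \<partial>M) \<le> ennreal (B\<^sup>2)"
    by (simp add: Liminf_const)
  show "g \<in> L2 M"
    unfolding L2_iff using g * by (auto intro: le_less_trans)
  then have "ennreal ((L2_norm M g)\<^sup>2) \<le> ennreal (B\<^sup>2)"
    using * by (simp add: nn_integral_L2)
  then have "(L2_norm M g)\<^sup>2 \<le> B\<^sup>2" by simp
  then show "L2_norm M g \<le> B"
    by (rule power2_le_imp_le) (rule B)
qed

text \<open>The weight 4^k is small enough that the weighted squares of the increments have total
  integral at most the sum of 4^k 16^(-k) = 4^(-k), yet large enough that finiteness at a point
  forces the increments below 2^(-k) from some index on. The telescoping series then converges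
  absolutely at almost every point.\<close>

lemma L2_fast_Cauchy_AE_convergent:
  assumes f: "\<And>k::nat. f k \<in> L2 M"
    and fast: "\<And>k. L2_norm M (\<lambda>x. f (Suc k) x - f k x) \<le> (1/4) ^ k"
  shows "AE x in M. convergent (\<lambda>k. f k x)"
proof -
  have [measurable]: "f k \<in> borel_measurable M" for k
    using f by (auto intro: L2_measurable)
  let ?d = "\<lambda>k x. cmod (f (Suc k) x - f k x)"
  have "(\<integral>\<^sup>+x. (\<Sum>k. ennreal (4 ^ k * (?d k x)\<^sup>2)) \<partial>M) = (\<Sum>k. \<integral>\<^sup>+x. ennreal (4 ^ k * (?d k x)\<^sup>2) \<partial>M)"
    by (rule nn_integral_suminf) measurable
  also have "\<dots> = (\<Sum>k. ennreal (4 ^ k * (L2_norm M (\<lambda>x. f (Suc k) x - f k x))\<^sup>2))"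
    by (intro suminf_cong)
      (simp add: ennreal_mult nn_integral_cmult nn_integral_L2[OF L2_diff[OF f f]])
  also have "\<dots> \<le> (\<Sum>k. ennreal ((1/4) ^ k))"
  proof (intro suminf_le summableI)
    fix k
    have "4 ^ k * (L2_norm M (\<lambda>x. f (Suc k) x - f k x))\<^sup>2 \<le> 4 ^ k * ((1/4) ^ k)\<^sup>2"
      by (intro mult_left_mono power_mono fast) auto
    also have "\<dots> = (1/4) ^ k"
      by (simp add: power2_eq_square power_divide)
    finally show "ennreal (4 ^ k * (L2_norm M (\<lambda>x. f (Suc k) x - f k x))\<^sup>2) \<le> ennreal ((1/4) ^ k)"
      by (rule ennreal_leI)
  qed
  also have "\<dots> = ennreal (\<Sum>k. (1/4) ^ k)"
    by (rule suminf_ennreal2) (auto intro: summable_geometric)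
  also have "\<dots> < \<infinity>" by simp
  finally have "AE x in M. (\<Sum>k. ennreal (4 ^ k * (?d k x)\<^sup>2)) \<noteq> \<infinity>"
    by (intro nn_integral_PInf_AE) auto
  then show ?thesis
  proof eventually_elim
    case (elim x)
    have "summable (\<lambda>k. 4 ^ k * (?d k x)\<^sup>2)"
      using elim by (intro summable_suminf_not_top) auto
    then have "(\<lambda>k. 4 ^ k * (?d k x)\<^sup>2) \<longlonglongrightarrow> 0"
      by (rule summable_LIMSEQ_zero)
    then have "eventually (\<lambda>k. 4 ^ k * (?d k x)\<^sup>2 < 1) sequentially"
      by (rule order_tendstoD) simp
    then have ev: "eventually (\<lambda>k. norm (f (Suc k) x - f k x) \<le> (1/2) ^ k) sequentially"
    proof eventually_elim
      case (elim k)
      have "(2 ^ k)\<^sup>2 = (4::real) ^ k"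
        by (simp add: power2_eq_square flip: power_mult_distrib)
      then have "(2 ^ k * ?d k x)\<^sup>2 \<le> 1\<^sup>2"
        using elim by (simp add: power_mult_distrib)
      then have "2 ^ k * ?d k x \<le> 1"
        by (rule power2_le_imp_le) simp
      then show ?case
        by (simp add: power_divide field_simps)
    qed
    have "summable (\<lambda>k. f (Suc k) x - f k x)"
      by (rule summable_comparison_test_ev[OF ev]) (simp add: summable_geometric)
    then have "convergent (\<lambda>n. \<Sum>k<n. f (Suc k) x - f k x)"
      by (simp add: summable_iff_convergent)
    then have "convergent (\<lambda>n. f n x - f 0 x)"
      by (simp add: sum_lessThan_telescope[of "\<lambda>k. f k x"])
    then have "convergent (\<lambda>n. (f n x - f 0 x) + f 0 x)"
      by (intro convergent_add convergent_const)
    then show ?case by simp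
  qed
qed

text \<open>The Riesz-Fischer argument: the limit is found pointwise along a rapidly converging
  subsequence.\<close>

lemma L2_complete:
  assumes f: "\<And>k::nat. f k \<in> L2 M"
    and Cauchy: "\<And>e. e > 0 \<Longrightarrow> \<exists>N. \<forall>j\<ge>N. \<forall>k\<ge>N. L2_norm M (\<lambda>x. f j x - f k x) \<le> e"
  obtains g where "g \<in> L2 M" "(\<lambda>k. L2_norm M (\<lambda>x. f k x - g x)) \<longlonglongrightarrow> 0"
proof -
  have [measurable]: "f k \<in> borel_measurable M" for k
    using f by (auto intro: L2_measurable)
  have "\<exists>N. \<forall>i. \<forall>j\<ge>N i. \<forall>k\<ge>N i. L2_norm M (\<lambda>x. f j x - f k x) \<le> (1/4) ^ i"
    by (intro choice allI Cauchy) simp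
  then obtain N where N: "\<And>i j k. j \<ge> N i \<Longrightarrow> k \<ge> N i \<Longrightarrow> L2_norm M (\<lambda>x. f j x - f k x) \<le> (1/4::real) ^ i"
    by blast
  \<comment> \<open>The sum makes \<open>r\<close> dominate each \<open>N i\<close> and be monotone
    although \<open>N\<close> need not be; the added \<open>i\<close> makes it strictly
    increasing.\<close>
  define r where "r i = (\<Sum>j\<le>i. N j) + i" for i :: nat
  have rN: "N i \<le> r i" for i
    unfolding r_def by (intro trans_le_add1 member_le_sum) auto
  have r_mono: "strict_mono r"
    by (rule strict_mono_Suc_iff[THEN iffD2]) (simp add: r_def)
  have rN': "N i \<le> r j" if "i \<le> j" for i j
    using rN[of i] strict_mono_leD[OF r_mono that] by linarith
  have "AE x in M. convergent (\<lambda>k. f (r k) x)"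
    by (rule L2_fast_Cauchy_AE_convergent) (auto intro!: f N rN' rN)
  then have lim: "AE x in M. (\<lambda>k. f (r k) x) \<longlonglongrightarrow> lim (\<lambda>k. f (r k) x)"
    by eventually_elim (simp add: convergent_LIMSEQ_iff)
  define g where "g x = lim (\<lambda>k. f (r k) x)" for x
  have [measurable]: "g \<in> borel_measurable M"
    unfolding g_def by measurable
  \<comment> \<open>Fatou is applied in j to \<open>f k - f (r j)\<close> with k fixed. This bounds
    the distance to \<open>g\<close> for the whole sequence and not only along the subsequence, and
    it puts the difference in L2 before \<open>g\<close> itself is known to be there.\<close>
  have diff: "(\<lambda>x. f k x - g x) \<in> L2 M" "L2_norm M (\<lambda>x. f k x - g x) \<le> (1/4) ^ i" if "k \<ge> N i" for k i
  proof -
    have ev: "\<forall>\<^sub>F j in sequentially. L2_norm M (\<lambda>x. f k x - f (r j) x) \<le> (1/4) ^ i"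
      using eventually_ge_at_top[of i] by eventually_elim (intro N that rN')
    have AE: "AE x in M. (\<lambda>j. f k x - f (r j) x) \<longlonglongrightarrow> f k x - g x"
      using lim by eventually_elim (auto simp: g_def intro!: tendsto_intros)
    show "(\<lambda>x. f k x - g x) \<in> L2 M" "L2_norm M (\<lambda>x. f k x - g x) \<le> (1/4) ^ i"
      by (rule L2_Fatou[OF L2_diff[OF f f] _ AE ev], measurable)+
  qed
  have "(\<lambda>x. f (N 0) x - (f (N 0) x - g x)) \<in> L2 M"
    by (rule L2_diff[OF f diff(1)[OF order_refl]])
  then have "g \<in> L2 M" by simp
  moreover have "(\<lambda>k. L2_norm M (\<lambda>x. f k x - g x)) \<longlonglongrightarrow> 0"
  proof (rule LIMSEQ_I)
    fix e :: real assume "e > 0"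
    then obtain i where i: "(1/4) ^ i < e"
      using real_arch_pow_inv[of e "1/4"] by auto
    show "\<exists>n0. \<forall>n\<ge>n0. norm (L2_norm M (\<lambda>x. f n x - g x) - 0) < e"
      using diff(2) i by (intro exI[of _ "N i"]) (auto intro: le_less_trans)
  qed
  ultimately show ?thesis by (rule that)
qed

section \<open>Gaussian regularisation\<close>

text \<open>A countable cover by Borel sets of finite measure also serves the completion. Fubini's
  theorem is needed for the completed measure, as the data are only Lebesgue measurable.\<close>

lemma sigma_finite_lebesgue: "sigma_finite_measure (lebesgue :: 'a::euclidean_space measure)"
proof -
  obtain A :: "'a set set" where "countable A" "A \<subseteq> sets lborel" "\<Union>A = space lborel"
    "\<And>a. a \<in> A \<Longrightarrow> emeasure lborel a \<noteq> \<infinity>"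
    using lborel.sigma_finite_countable by metis
  then show ?thesis
    by (intro sigma_finite_measure.intro exI[of _ A]) (auto simp: subset_iff)
qed

interpretation lebesgue: sigma_finite_measure "lebesgue :: 'a::euclidean_space measure"
  by (rule sigma_finite_lebesgue)

interpretation lebesgue_pair: pair_sigma_finite
  "lebesgue :: 'a::euclidean_space measure" "lebesgue :: 'b::euclidean_space measure" ..

lemma borel_measurable_cis [measurable (raw)]:
  "f \<in> borel_measurable M \<Longrightarrow> (\<lambda>x. cis (f x)) \<in> borel_measurable M"
  by (rule measurable_compose[OF _ borel_measurable_continuous_onI]) (auto intro!: continuous_intros)

lemma borel_measurable_imp_lebesgue:
  "f \<in> borel_measurable borel \<Longrightarrow> f \<in> borel_measurable (lebesgue :: 'a::euclidean_space measure)"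
  by (rule measurable_completion) simp

lemma measurable_lebesgue_inner [measurable]:
  "(\<lambda>p. fst p \<bullet> snd p) \<in>
     borel_measurable (lebesgue \<Otimes>\<^sub>M (lebesgue :: 'a::euclidean_space measure))"
proof -
  \<comment> \<open>Writing each coordinate as \<open>id\<close> of a projection exhibits it as a
    map from the completed sigma-algebra to \<open>borel\<close>, where the inner product is
    measurable.\<close>
  have [measurable]: "id \<in> (lebesgue :: 'a measure) \<rightarrow>\<^sub>M borel"
    by (rule borel_measurable_imp_lebesgue) simp
  have "(\<lambda>p. id (fst p) \<bullet> id (snd p)) \<in>
     borel_measurable (lebesgue \<Otimes>\<^sub>M (lebesgue :: 'a measure))"
    by measurable
  then show ?thesis by simp
qed

section \<open>Fubini's theorem for the Fourier kernel\<close>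

lemma integrable_bounded_mult:
  assumes "integrable M f" "\<And>x. cmod (h x) \<le> B" "h \<in> borel_measurable M"
  shows "integrable M (\<lambda>x. h x * f x :: complex)"
proof (rule Bochner_Integration.integrable_bound)
  show "integrable M (\<lambda>x. B * norm (f x))"
    using assms(1) by simp
  show "(\<lambda>x. h x * f x) \<in> borel_measurable M"
    using assms by measurable
  have "cmod (h x) * cmod (f x) \<le> \<bar>B\<bar> * cmod (f x)" for x
    using assms(2)[of x] by (intro mult_right_mono) auto
  then show "AE x in M. norm (h x * f x) \<le> norm (B * norm (f x))"
    by (simp add: norm_mult abs_mult)
qed

text \<open>The kernel has modulus 1, so the double integral is dominated by the product of the two
  L1 norms. The parameter \<open>s\<close> serves the transform (\<open>s = -1\<close>) and its
  conjugate (\<open>s = 1\<close>) at once.\<close>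

lemma fourier_Fubini:
  fixes p q :: "'a::euclidean_space \<Rightarrow> complex"
  assumes p: "integrable lebesgue p" and q: "integrable lebesgue q"
  shows "(LINT \<xi>|lebesgue. p \<xi> * (LINT x|lebesgue. cis (s * (x \<bullet> \<xi>)) * q x))
       = (LINT x|lebesgue. q x * (LINT \<xi>|lebesgue. cis (s * (x \<bullet> \<xi>)) * p \<xi>))"
proof -
  let ?f = "\<lambda>\<xi> x. p \<xi> * (cis (s * (x \<bullet> \<xi>)) * q x)"
  have [measurable]: "p \<in> borel_measurable lebesgue" "q \<in> borel_measurable lebesgue"
    using p q by auto
  have m: "(\<lambda>(\<xi>, x). ?f \<xi> x) \<in> borel_measurable (lebesgue \<Otimes>\<^sub>M lebesgue)"
    using measurable_lebesgue_inner by (simp add: case_prod_beta inner_commute) measurable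
  have "integrable (lebesgue \<Otimes>\<^sub>M lebesgue) (\<lambda>(\<xi>, x). ?f \<xi> x)"
  proof (rule lebesgue_pair.Fubini_integrable[OF m])
    show "integrable lebesgue (\<lambda>\<xi>. LINT x|lebesgue. norm (case (\<xi>, x) of (\<xi>, x) \<Rightarrow> ?f \<xi> x))"
      using p by (simp add: norm_mult integrable_norm)
    have "integrable lebesgue (\<lambda>x. cis (s * (x \<bullet> \<xi>)) * q x)" for \<xi>
      by (rule integrable_bounded_mult[OF q, of _ 1])
        (auto intro!: borel_measurable_imp_lebesgue borel_measurable_cis)
    then show "AE \<xi> in lebesgue. integrable lebesgue (\<lambda>x. case (\<xi>, x) of (\<xi>, x) \<Rightarrow> ?f \<xi> x)"
      by (intro AE_I2) (simp add: integrable_mult_right)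
  qed
  then have "(LINT \<xi>|lebesgue. LINT x|lebesgue. ?f \<xi> x) = (LINT x|lebesgue. LINT \<xi>|lebesgue. ?f \<xi> x)"
    by (rule lebesgue_pair.Fubini_integral[symmetric])
  moreover have "(\<lambda>x. LINT \<xi>|lebesgue. ?f \<xi> x)
      = (\<lambda>x. LINT \<xi>|lebesgue. q x * (cis (s * (x \<bullet> \<xi>)) * p \<xi>))"
    by (simp add: mult_ac)
  ultimately show ?thesis by simp
qed

lemma fourier_integral_cis:
  "fourier_integral g \<xi> = (LINT x|lebesgue. cis (- (x \<bullet> \<xi>)) * g x)"
  by (simp add: fourier_integral_def cis_conv_exp)

lemma integrable_fourier_integrand:
  fixes g :: "'a::euclidean_space \<Rightarrow> complex"
  assumes "integrable lebesgue g"
  shows "integrable lebesgue (\<lambda>x. cis (- (x \<bullet> \<xi>)) * g x)"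
  by (rule integrable_bounded_mult[OF assms, of _ 1])
    (auto intro!: borel_measurable_imp_lebesgue borel_measurable_cis)

lemma fourier_integral_measurable:
  fixes g :: "real ^ 'n \<Rightarrow> complex"
  assumes g: "g \<in> borel_measurable lebesgue"
  shows "fourier_integral g \<in> borel_measurable lebesgue"
proof -
  note [measurable] = g
  have "(\<lambda>(\<xi>, x). cis (- (x \<bullet> \<xi>)) * g x) \<in> borel_measurable (lebesgue \<Otimes>\<^sub>M lebesgue)"
    using measurable_lebesgue_inner by (simp add: case_prod_beta inner_commute) measurable
  then show ?thesis
    unfolding fourier_integral_cis[abs_def] by (rule lebesgue.borel_measurable_lebesgue_integral)
qed

lemma fourier_integral_bound: "cmod (fourier_integral g \<xi>) \<le> L1_norm lebesgue g"
  unfolding fourier_integral_cis L1_norm_def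
  using integral_norm_bound[of lebesgue "\<lambda>x. cis (- (x \<bullet> \<xi>)) * g x"] by (simp add: norm_mult)

lemma fourier_integral_diff:
  assumes "integrable lebesgue f" "integrable lebesgue g"
  shows "fourier_integral (\<lambda>x. f x - g x) \<xi> = fourier_integral f \<xi> - fourier_integral g \<xi>"
  unfolding fourier_integral_cis
  by (simp add: right_diff_distrib integrable_fourier_integrand assms)

text \<open>The factor 1 in the phase is kept so that the right-hand side has the shape of the inner
  integral in \<open>fourier_Fubini\<close>.\<close>

lemma cnj_fourier_integral:
  "cnj (fourier_integral g \<xi>) = (LINT x|lebesgue. cis (1 * (x \<bullet> \<xi>)) * cnj (g x))"
  unfolding fourier_integral_cis by (simp flip: Bochner_Integration.integral_cnj add: cis_cnj)

text \<open>\<open>lborel\<close> is the image of a product of one-dimensional Lebesgue measures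
  under the coordinate map, so Fubini for finite products applies. It reduces the Gaussian integral
  to dimension one.\<close>

lemma
  fixes f :: "'a::euclidean_space \<Rightarrow> real \<Rightarrow> complex"
  assumes f: "\<And>b. b \<in> Basis \<Longrightarrow> integrable lborel (f b)"
  shows lborel_integrable_prod: "integrable lborel (\<lambda>x. \<Prod>b\<in>Basis. f b (x \<bullet> b))"
    and lborel_integral_prod:
      "(LINT x|lborel. (\<Prod>b\<in>Basis. f b (x \<bullet> b))) = (\<Prod>b\<in>Basis. LINT y|lborel. f b y)"
proof -
  interpret product_sigma_finite "\<lambda>_::'a. lborel :: real measure" ..
  let ?P = "\<Pi>\<^sub>M b\<in>(Basis::'a set). (lborel :: real measure)"
  let ?T = "\<lambda>y::'a \<Rightarrow> real. \<Sum>b\<in>Basis. y b *\<^sub>R b"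
  have [measurable]: "f b \<in> borel_measurable borel" if "b \<in> Basis" for b
    using borel_measurable_integrable[OF f[OF that]] by simp
  have T: "?T \<in> ?P \<rightarrow>\<^sub>M borel" by measurable
  have m: "(\<lambda>x. \<Prod>b\<in>Basis. f b (x \<bullet> b)) \<in> borel_measurable borel" by measurable
  have eq: "(\<Prod>b\<in>Basis. f b (?T y \<bullet> b)) = (\<Prod>b\<in>Basis. f b (y b))" for y
    by (intro prod.cong refl) (simp add: inner_sum_left inner_Basis if_distrib cong: if_cong)
  show "integrable lborel (\<lambda>x. \<Prod>b\<in>Basis. f b (x \<bullet> b))"
    unfolding lborel_eq[where 'a='a] integrable_distr_eq[OF T m] eq
    by (rule product_integrable_prod) (auto intro: f)
  show "(LINT x|lborel. (\<Prod>b\<in>Basis. f b (x \<bullet> b))) = (\<Prod>b\<in>Basis. LINT y|lborel. f b y)"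
    unfolding lborel_eq[where 'a='a] integral_distr[OF T m] eq
    by (rule product_integral_prod) (auto intro: f)
qed

text \<open>Up to the factor sqrt (2 pi), this is the characteristic function of the standard normal
  distribution.\<close>

lemma
  fixes t :: real
  shows integrable_gauss_1: "integrable lborel (\<lambda>x. cis (t * x) * complex_of_real (exp (- x\<^sup>2 / 2)))"
    and integral_gauss_1: "(LINT x|lborel. cis (t * x) * complex_of_real (exp (- x\<^sup>2 / 2)))
        = complex_of_real (sqrt (2 * pi) * exp (- t\<^sup>2 / 2))"
proof -
  have eq: "cis (t * x) * complex_of_real (exp (- x\<^sup>2 / 2))
      = complex_of_real (sqrt (2 * pi)) * (cis (t * x) * complex_of_real (std_normal_density x))" for x
    by (simp add: std_normal_density_def)
  have "integrable lborel (\<lambda>x. complex_of_real (std_normal_density x))"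
    by (rule integrable_of_real) simp
  then have "integrable lborel (\<lambda>x. cis (t * x) * complex_of_real (std_normal_density x))"
    by (rule integrable_bounded_mult[of _ _ _ 1]) auto
  then show "integrable lborel (\<lambda>x. cis (t * x) * complex_of_real (exp (- x\<^sup>2 / 2)))"
    unfolding eq by (rule integrable_mult_right)
  have "char std_normal_distribution t = (LINT x|lborel. cis (t * x) * complex_of_real (std_normal_density x))"
    unfolding char_def
    by (subst integral_density)
      (auto simp: cis_conv_exp scaleR_conv_of_real mult.commute intro!: normal_density_nonneg)
  then show "(LINT x|lborel. cis (t * x) * complex_of_real (exp (- x\<^sup>2 / 2)))
        = complex_of_real (sqrt (2 * pi) * exp (- t\<^sup>2 / 2))"
    unfolding eq by (simp add: char_std_normal_distribution)
qed

text \<open>This scaling makes the function its own transform up to a constant factor.\<close>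

definition gauss :: "'a::euclidean_space \<Rightarrow> real" where
  "gauss x = exp (- (norm x)\<^sup>2 / 2)"

lemma gauss_measurable [measurable]: "gauss \<in> borel_measurable borel"
  unfolding gauss_def[abs_def] by measurable

text \<open>Both the phase and the Gaussian are products over the coordinates, so the integral is a
  product of one-dimensional ones.\<close>

lemma
  fixes w :: "'a::euclidean_space"
  shows integrable_cis_gauss: "integrable lebesgue (\<lambda>x. cis (x \<bullet> w) * complex_of_real (gauss x))"
    and integral_cis_gauss: "(LINT x|lebesgue. cis (x \<bullet> w) * complex_of_real (gauss x))
        = complex_of_real (sqrt (2 * pi) ^ DIM('a) * gauss w)"
proof -
  have gauss: "gauss x = (\<Prod>b\<in>Basis. exp (- (x \<bullet> b)\<^sup>2 / 2))" for x :: 'a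
    unfolding gauss_def exp_sum[OF finite_Basis, symmetric] sum_divide_distrib[symmetric] sum_negf
      power2_norm_eq_inner
    by (subst euclidean_inner) (simp add: power2_eq_square)
  have cis_sum: "cis (\<Sum>b\<in>A. h b) = (\<Prod>b\<in>A. cis (h b))" if "finite A" for h :: "'a \<Rightarrow> real" and A
    using that by induction (auto simp: cis_mult[symmetric])
  have eq: "cis (x \<bullet> w) * complex_of_real (gauss x)
      = (\<Prod>b\<in>Basis. cis ((w \<bullet> b) * (x \<bullet> b)) * complex_of_real (exp (- (x \<bullet> b)\<^sup>2 / 2)))" for x
    by (simp add: gauss prod.distrib euclidean_inner[of x w] cis_sum mult.commute)
  have m: "(\<lambda>x::'a. cis (x \<bullet> w) * complex_of_real (gauss x)) \<in> borel_measurable lborel"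
    by measurable
  show "integrable lebesgue (\<lambda>x. cis (x \<bullet> w) * complex_of_real (gauss x))"
    unfolding integrable_completion[OF m] unfolding eq
    by (rule lborel_integrable_prod) (rule integrable_gauss_1)
  have "(LINT x|lborel. cis (x \<bullet> w) * complex_of_real (gauss x))
      = (\<Prod>b\<in>Basis. complex_of_real (sqrt (2 * pi) * exp (- (w \<bullet> b)\<^sup>2 / 2)))"
    unfolding eq by (subst lborel_integral_prod[OF integrable_gauss_1]) (simp only: integral_gauss_1)
  also have "\<dots> = complex_of_real (sqrt (2 * pi) ^ DIM('a) * gauss w)"
    by (simp add: gauss prod.distrib)
  finally show "(LINT x|lebesgue. cis (x \<bullet> w) * complex_of_real (gauss x))
        = complex_of_real (sqrt (2 * pi) ^ DIM('a) * gauss w)"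
    by (simp add: integral_completion[OF m])
qed

lemma integrable_gauss: "integrable lebesgue (\<lambda>x::'a::euclidean_space. gauss x)"
  using integrable_norm[OF integrable_cis_gauss[of "0::'a"]] by (simp add: gauss_def)

text \<open>The substitution rule is that of \<open>lborel\<close>; Borel measurability of
  \<open>f\<close> allows both integrals to be moved between \<open>lborel\<close> and its
  completion.\<close>

lemma lebesgue_integral_affine:
  fixes f :: "'a::euclidean_space \<Rightarrow> complex"
  assumes f [measurable]: "f \<in> borel_measurable borel" and c: "c \<noteq> 0"
  shows "(LINT x|lebesgue. f x) = \<bar>c\<bar> ^ DIM('a) *\<^sub>R (LINT x|lebesgue. f (t + c *\<^sub>R x))"
proof -
  have "(LINT x|lborel. f x) = \<bar>c\<bar> ^ DIM('a) *\<^sub>R (LINT x|lborel. f (t + c *\<^sub>R x))"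
    by (subst lborel_affine[OF c, of t]) (simp add: integral_density integral_distr)
  then show ?thesis
    by (simp add: integral_completion)
qed

lemma lebesgue_integrable_affine:
  fixes f :: "'a::euclidean_space \<Rightarrow> real"
  assumes f [measurable]: "f \<in> borel_measurable borel" and c: "c \<noteq> 0" and int: "integrable lebesgue f"
  shows "integrable lebesgue (\<lambda>x. f (t + c *\<^sub>R x))"
proof -
  have "integrable lborel f"
    using int by (simp add: integrable_completion)
  then have "integrable lborel (\<lambda>x. f (t + c *\<^sub>R x))"
    using c by (subst (asm) lborel_affine[OF c, of t])
      (simp add: integrable_density integrable_distr_eq)
  then show ?thesis
    by (simp add: integrable_completion)
qed

text \<open>Fubini is used twice, once for each factor of the squared modulus. What remains in
  frequency is the integral of the weight against a pure phase, which is an explicit Gaussian in y -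
  x; the substitution y = x + \<epsilon> z then leaves a Gaussian that does not depend on
  \<epsilon>.\<close>

lemma gaussian_Plancherel:
  fixes g :: "real ^ 'n \<Rightarrow> complex"
  assumes int: "integrable lebesgue g" and g [measurable]: "g \<in> borel_measurable borel" and \<epsilon>: "\<epsilon> > 0"
  shows "integrable lebesgue (\<lambda>\<xi>. (cmod (fourier_integral g \<xi>))\<^sup>2 * gauss (\<epsilon> *\<^sub>R \<xi>))"
    and "complex_of_real (LINT \<xi>|lebesgue. (cmod (fourier_integral g \<xi>))\<^sup>2 * gauss (\<epsilon> *\<^sub>R \<xi>))
      = complex_of_real (sqrt (2 * pi) ^ CARD('n)) *
        (LINT x|lebesgue. g x * (LINT z|lebesgue. cnj (g (x + \<epsilon> *\<^sub>R z)) * complex_of_real (gauss z)))"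
proof -
  let ?c = "complex_of_real (sqrt (2 * pi) ^ CARD('n))"
  define W where "W = (\<lambda>\<xi>::real^'n. complex_of_real (gauss (\<epsilon> *\<^sub>R \<xi>)))"
  have [measurable]: "W \<in> borel_measurable borel"
    unfolding W_def by measurable
  have W: "integrable lebesgue W"
    unfolding W_def using lebesgue_integrable_affine[OF gauss_measurable _ integrable_gauss, of \<epsilon> 0] \<epsilon>
    by (intro integrable_of_real) simp
  have F [measurable]: "fourier_integral g \<in> borel_measurable lebesgue"
    using int by (intro fourier_integral_measurable) auto
  \<comment> \<open>Grouping the conjugate transform with the weight yields an integrable function,
    since the transform is bounded by the L1 norm of \<open>g\<close>. The remaining factor can then
    be unfolded by Fubini.\<close>
  define K where "K \<xi> = cnj (fourier_integral g \<xi>) * W \<xi>" for \<xi>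
  have K: "integrable lebesgue K"
    unfolding K_def
    by (rule integrable_bounded_mult[OF W, where B="L1_norm lebesgue g"])
      (simp_all add: fourier_integral_bound borel_measurable_cnj F)
  have KF: "K \<xi> * fourier_integral g \<xi> = complex_of_real ((cmod (fourier_integral g \<xi>))\<^sup>2 * gauss (\<epsilon> *\<^sub>R \<xi>))" for \<xi>
    by (simp add: K_def W_def complex_norm_square del: of_real_power)
  have "integrable lebesgue (\<lambda>\<xi>. fourier_integral g \<xi> * K \<xi>)"
    by (rule integrable_bounded_mult[OF K fourier_integral_bound F])
  then have "integrable lebesgue (\<lambda>\<xi>. K \<xi> * fourier_integral g \<xi>)"
    by (simp add: mult.commute)
  then show "integrable lebesgue (\<lambda>\<xi>. (cmod (fourier_integral g \<xi>))\<^sup>2 * gauss (\<epsilon> *\<^sub>R \<xi>))"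
    unfolding KF complex_of_real_integrable_eq .
  \<comment> \<open>The substitution \<eta> = \<epsilon> \<xi> reduces the weight to
    \<open>gauss\<close> and moves the scale into the phase, at the price of the Jacobian
    \<epsilon>^(-n).\<close>
  have gauss_scaled: "(LINT \<xi>|lebesgue. cis (1 * (y \<bullet> \<xi>)) * (cis (- (x \<bullet> \<xi>)) * W \<xi>))
      = inverse (\<epsilon> ^ CARD('n)) *\<^sub>R (?c * complex_of_real (gauss ((y - x) /\<^sub>R \<epsilon>)))" for x y :: "real^'n"
  proof -
    define h where "h \<eta> = cis (\<eta> \<bullet> ((y - x) /\<^sub>R \<epsilon>)) * complex_of_real (gauss \<eta>)" for \<eta> :: "real^'n"
    have [measurable]: "h \<in> borel_measurable borel"
      unfolding h_def[abs_def] by measurable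
    have "cis (1 * (y \<bullet> \<xi>)) * (cis (- (x \<bullet> \<xi>)) * W \<xi>) = h (0 + \<epsilon> *\<^sub>R \<xi>)" for \<xi>
      using \<epsilon> by (simp add: h_def W_def cis_mult inner_diff_right inner_commute mult.assoc[symmetric])
    moreover have "(LINT \<xi>|lebesgue. h \<xi>) = ?c * complex_of_real (gauss ((y - x) /\<^sub>R \<epsilon>))"
      unfolding h_def using integral_cis_gauss[of "(y - x) /\<^sub>R \<epsilon>"] by simp
    ultimately have "\<epsilon> ^ CARD('n) *\<^sub>R (LINT \<xi>|lebesgue. cis (1 * (y \<bullet> \<xi>)) * (cis (- (x \<bullet> \<xi>)) * W \<xi>))
        = ?c * complex_of_real (gauss ((y - x) /\<^sub>R \<epsilon>))"
      using lebesgue_integral_affine[of h \<epsilon> 0] \<epsilon> by simp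
    from arg_cong[OF this, of "\<lambda>v. inverse (\<epsilon> ^ CARD('n)) *\<^sub>R v"] show ?thesis
      using \<epsilon> by simp
  qed
  have inner: "(LINT \<xi>|lebesgue. cis (-1 * (x \<bullet> \<xi>)) * K \<xi>)
      = ?c * (LINT z|lebesgue. cnj (g (x + \<epsilon> *\<^sub>R z)) * complex_of_real (gauss z))" for x
  proof -
    have "integrable lebesgue (\<lambda>\<xi>. cis (- (x \<bullet> \<xi>)) * W \<xi>)"
      using integrable_fourier_integrand[OF W, of x] by (simp add: inner_commute)
    then have "(LINT \<xi>|lebesgue. (cis (- (x \<bullet> \<xi>)) * W \<xi>) * (LINT y|lebesgue. cis (1 * (y \<bullet> \<xi>)) * cnj (g y)))
      = (LINT y|lebesgue. cnj (g y) * (LINT \<xi>|lebesgue. cis (1 * (y \<bullet> \<xi>)) * (cis (- (x \<bullet> \<xi>)) * W \<xi>)))"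
      by (intro fourier_Fubini) (simp_all add: int)
    also have "\<dots> = (LINT y|lebesgue. inverse (\<epsilon> ^ CARD('n)) *\<^sub>R (?c * (cnj (g y) * complex_of_real (gauss ((y - x) /\<^sub>R \<epsilon>)))))"
      unfolding gauss_scaled by (simp add: mult_ac)
    also have "\<dots> = inverse (\<epsilon> ^ CARD('n)) *\<^sub>R (?c * (LINT y|lebesgue. cnj (g y) * complex_of_real (gauss ((y - x) /\<^sub>R \<epsilon>))))"
      by simp
    \<comment> \<open>The Jacobian \<epsilon>^n of this substitution cancels the earlier factor
      \<epsilon>^(-n).\<close>
    also have "(LINT y|lebesgue. cnj (g y) * complex_of_real (gauss ((y - x) /\<^sub>R \<epsilon>)))
       = \<epsilon> ^ CARD('n) *\<^sub>R (LINT z|lebesgue. cnj (g (x + \<epsilon> *\<^sub>R z)) * complex_of_real (gauss z))"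
      by (subst lebesgue_integral_affine[of _ \<epsilon> x]) (use \<epsilon> in auto)
    finally show ?thesis
      using \<epsilon> by (simp add: K_def cnj_fourier_integral mult_ac)
  qed
  have "complex_of_real (LINT \<xi>|lebesgue. (cmod (fourier_integral g \<xi>))\<^sup>2 * gauss (\<epsilon> *\<^sub>R \<xi>))
      = (LINT \<xi>|lebesgue. K \<xi> * fourier_integral g \<xi>)"
    unfolding KF by (rule integral_complex_of_real[symmetric])
  also have "\<dots> = (LINT \<xi>|lebesgue. K \<xi> * (LINT x|lebesgue. cis (-1 * (x \<bullet> \<xi>)) * g x))"
    by (simp add: fourier_integral_cis)
  also have "\<dots> = (LINT x|lebesgue. g x * (LINT \<xi>|lebesgue. cis (-1 * (x \<bullet> \<xi>)) * K \<xi>))"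
    by (rule fourier_Fubini[OF K int])
  also have "\<dots> = ?c * (LINT x|lebesgue. g x * (LINT z|lebesgue. cnj (g (x + \<epsilon> *\<^sub>R z)) * complex_of_real (gauss z)))"
    unfolding inner mult.left_commute[of "g _" ?c] by (rule integral_mult_right_zero)
  finally show "complex_of_real (LINT \<xi>|lebesgue. (cmod (fourier_integral g \<xi>))\<^sup>2 * gauss (\<epsilon> *\<^sub>R \<xi>))
      = ?c * (LINT x|lebesgue. g x * (LINT z|lebesgue. cnj (g (x + \<epsilon> *\<^sub>R z)) * complex_of_real (gauss z)))" .
qed

text \<open>The two sides of \<open>gaussian_Plancherel\<close> need different limit theorems. In
  space, continuity gives pointwise convergence and the bound M gives majorants, so dominated
  convergence applies to the inner and to the outer integral. In frequency no majorant is known, but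
  the integrands increase to the squared modulus.\<close>

lemma Plancherel_continuous:
  fixes g :: "real ^ 'n \<Rightarrow> complex"
  assumes int: "integrable lebesgue g" and cont: "continuous_on UNIV g" and M: "\<And>x. cmod (g x) \<le> M"
  shows "fourier_integral g \<in> L2 lebesgue"
    and "L2_norm lebesgue (fourier_integral g) = sqrt ((2 * pi) ^ CARD('n)) * L2_norm lebesgue g"
proof -
  have g [measurable]: "g \<in> borel_measurable borel"
    using cont by (rule borel_measurable_continuous_onI)
  have gl [measurable]: "g \<in> borel_measurable lebesgue"
    using int by auto
  have F [measurable]: "fourier_integral g \<in> borel_measurable lebesgue"
    by (rule fourier_integral_measurable) measurable
  let ?s = "sqrt (2 * pi) ^ CARD('n)"
  have ss: "?s * ?s = (2 * pi) ^ CARD('n)"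
    unfolding power_mult_distrib[symmetric] by simp
  have int_gauss: "(LINT z|lebesgue. gauss (z::real^'n)) = ?s"
  proof -
    have "complex_of_real (LINT z|lebesgue. gauss (z::real^'n)) = complex_of_real ?s"
      using integral_cis_gauss[of "0::real^'n"] by (simp add: gauss_def)
    then show ?thesis by (simp only: of_real_eq_iff)
  qed
  \<comment> \<open>A decreasing sequence is chosen so that the Gaussian weights increase with
    k.\<close>
  define \<epsilon> where "\<epsilon> k = inverse (real (Suc k))" for k
  have \<epsilon>_pos: "\<epsilon> k > 0" for k by (simp add: \<epsilon>_def)
  have \<epsilon>_lim: "\<epsilon> \<longlonglongrightarrow> 0"
    unfolding \<epsilon>_def by (rule LIMSEQ_inverse_real_of_nat)
  have \<epsilon>_anti: "\<epsilon> n \<le> \<epsilon> m" if "m \<le> n" for m n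
    using that by (auto simp: \<epsilon>_def intro!: le_imp_inverse_le)
  let ?J = "\<lambda>k x. LINT z|lebesgue. cnj (g (x + \<epsilon> k *\<^sub>R z)) * complex_of_real (gauss z)"
  have J_lim: "(\<lambda>k. ?J k x) \<longlonglongrightarrow> (LINT z::real^'n|lebesgue. cnj (g x) * complex_of_real (gauss z))" for x
  proof (rule integral_dominated_convergence)
    show "integrable lebesgue (\<lambda>z::real^'n. M * gauss z)"
      using integrable_gauss by (rule integrable_mult_right)
    have "(\<lambda>k. cnj (g (x + \<epsilon> k *\<^sub>R z)) * complex_of_real (gauss z)) \<longlonglongrightarrow> cnj (g x) * complex_of_real (gauss z)" for z
    proof -
      have "(\<lambda>k. x + \<epsilon> k *\<^sub>R z) \<longlonglongrightarrow> x + 0 *\<^sub>R z"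
        by (intro tendsto_intros \<epsilon>_lim)
      then have "(\<lambda>k. g (x + \<epsilon> k *\<^sub>R z)) \<longlonglongrightarrow> g x"
        using continuous_on_tendsto_compose[OF cont] by auto
      then show ?thesis by (intro tendsto_intros)
    qed
    then show "AE z in lebesgue. (\<lambda>k. cnj (g (x + \<epsilon> k *\<^sub>R z)) * complex_of_real (gauss z)) \<longlonglongrightarrow> cnj (g x) * complex_of_real (gauss z)"
      by simp
    show "AE z in lebesgue. norm (cnj (g (x + \<epsilon> k *\<^sub>R z)) * complex_of_real (gauss z)) \<le> M * gauss z" for k
      by (simp add: norm_mult gauss_def M)
  qed (rule borel_measurable_imp_lebesgue, measurable)+
  have J_le: "cmod (?J k x) \<le> M * ?s" for k x
  proof -
    have "cmod (?J k x) \<le> (LINT z|lebesgue. M * gauss (z::real^'n))"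
    proof (rule Bochner_Integration.integral_norm_bound_integral)
      show "integrable lebesgue (\<lambda>z::real^'n. M * gauss z)"
        using integrable_gauss by (rule integrable_mult_right)
      show "integrable lebesgue (\<lambda>z. cnj (g (x + \<epsilon> k *\<^sub>R z)) * complex_of_real (gauss z))"
        by (rule integrable_bounded_mult[of _ _ _ M])
          (simp_all add: M integrable_of_real integrable_gauss borel_measurable_imp_lebesgue borel_measurable_cnj)
      show "norm (cnj (g (x + \<epsilon> k *\<^sub>R z)) * complex_of_real (gauss z)) \<le> M * gauss z" for z
        by (simp add: norm_mult gauss_def M)
    qed
    then show ?thesis by (simp add: int_gauss)
  qed
  have "(\<lambda>k. LINT x|lebesgue. g x * ?J k x) \<longlonglongrightarrow>
      (LINT x|lebesgue. g x * (LINT z::real^'n|lebesgue. cnj (g x) * complex_of_real (gauss z)))"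
  proof (rule integral_dominated_convergence)
    show "integrable lebesgue (\<lambda>x. M * ?s * cmod (g x))"
      using int by simp
    show "AE x in lebesgue. (\<lambda>k. g x * ?J k x) \<longlonglongrightarrow> g x * (LINT z::real^'n|lebesgue. cnj (g x) * complex_of_real (gauss z))"
      by (intro AE_I2 tendsto_intros J_lim)
    show "AE x in lebesgue. norm (g x * ?J k x) \<le> M * ?s * cmod (g x)" for k
      using J_le by (auto simp: norm_mult mult.commute intro!: mult_left_mono)
    \<comment> \<open>Over \<open>lborel\<close> the integrand is jointly Borel measurable, which
      gives measurability of the inner integral in x.\<close>
    have "?J k x = (LINT z|lborel. cnj (g (x + \<epsilon> k *\<^sub>R z)) * complex_of_real (gauss z))" for k x
      by (rule integral_completion) measurable
    moreover have "(\<lambda>x. LINT z|lborel. cnj (g (x + \<epsilon> k *\<^sub>R z)) * complex_of_real (gauss z)) \<in> borel_measurable borel" for k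
      by measurable
    ultimately show "(\<lambda>x. g x * ?J k x) \<in> borel_measurable lebesgue" for k
      by (simp add: borel_measurable_times borel_measurable_imp_lebesgue)
  qed simp
  also have "(LINT x|lebesgue. g x * (LINT z::real^'n|lebesgue. cnj (g x) * complex_of_real (gauss z)))
      = complex_of_real ?s * complex_of_real (LINT x|lebesgue. (cmod (g x))\<^sup>2)"
  proof -
    have "(LINT z::real^'n|lebesgue. cnj (g x) * complex_of_real (gauss z)) = cnj (g x) * complex_of_real ?s" for x
      by (simp only: integral_mult_right_zero integral_complex_of_real int_gauss)
    then have "(LINT x|lebesgue. g x * (LINT z::real^'n|lebesgue. cnj (g x) * complex_of_real (gauss z)))
        = (LINT x|lebesgue. complex_of_real ?s * complex_of_real ((cmod (g x))\<^sup>2))"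
      by (simp only: complex_norm_square mult_ac)
    then show ?thesis
      by (simp only: integral_mult_right_zero integral_complex_of_real)
  qed
  finally have "(\<lambda>k. complex_of_real (LINT \<xi>|lebesgue. (cmod (fourier_integral g \<xi>))\<^sup>2 * gauss (\<epsilon> k *\<^sub>R \<xi>)))
      \<longlonglongrightarrow> complex_of_real ?s * (complex_of_real ?s * complex_of_real (LINT x|lebesgue. (cmod (g x))\<^sup>2))"
    unfolding gaussian_Plancherel(2)[OF int g \<epsilon>_pos] by (intro tendsto_mult tendsto_const)
  \<comment> \<open>One factor sqrt (2 pi)^n comes from the transform of the Gaussian, the other
    from its total mass; together they give (2 pi)^n.\<close>
  then have lim: "(\<lambda>k. LINT \<xi>|lebesgue. (cmod (fourier_integral g \<xi>))\<^sup>2 * gauss (\<epsilon> k *\<^sub>R \<xi>))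
      \<longlonglongrightarrow> (2 * pi) ^ CARD('n) * (LINT x|lebesgue. (cmod (g x))\<^sup>2)"
    unfolding ss[symmetric] by (simp only: mult.assoc tendsto_of_real_iff of_real_mult[symmetric])
  have mono: "mono (\<lambda>k. (cmod (fourier_integral g \<xi>))\<^sup>2 * gauss (\<epsilon> k *\<^sub>R \<xi>))" for \<xi>
  proof (rule monoI)
    fix m n :: nat assume "m \<le> n"
    have "(\<epsilon> n * norm \<xi>)\<^sup>2 \<le> (\<epsilon> m * norm \<xi>)\<^sup>2"
      using \<epsilon>_anti[OF \<open>m \<le> n\<close>] \<epsilon>_pos[of n] by (intro power_mono mult_right_mono) auto
    then show "(cmod (fourier_integral g \<xi>))\<^sup>2 * gauss (\<epsilon> m *\<^sub>R \<xi>) \<le> (cmod (fourier_integral g \<xi>))\<^sup>2 * gauss (\<epsilon> n *\<^sub>R \<xi>)"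
      using \<epsilon>_pos by (intro mult_left_mono) (auto simp: gauss_def abs_of_pos)
  qed
  have ptw: "(\<lambda>k. (cmod (fourier_integral g \<xi>))\<^sup>2 * gauss (\<epsilon> k *\<^sub>R \<xi>)) \<longlonglongrightarrow> (cmod (fourier_integral g \<xi>))\<^sup>2" for \<xi>
  proof -
    have "(\<lambda>k. (cmod (fourier_integral g \<xi>))\<^sup>2 * exp (- (norm (\<epsilon> k *\<^sub>R \<xi>))\<^sup>2 / 2))
        \<longlonglongrightarrow> (cmod (fourier_integral g \<xi>))\<^sup>2 * exp (- (norm (0 *\<^sub>R \<xi>))\<^sup>2 / 2)"
      by (intro tendsto_intros \<epsilon>_lim) auto
    then show ?thesis by (simp add: gauss_def)
  qed
  \<comment> \<open>Monotone convergence supplies the integrability of the limit as well as its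
    integral, hence both claims.\<close>
  note conv = gaussian_Plancherel(1)[OF int g \<epsilon>_pos] AE_I2[OF mono] AE_I2[OF ptw] lim
  have sq: "(\<lambda>\<xi>. (cmod (fourier_integral g \<xi>))\<^sup>2) \<in> borel_measurable lebesgue"
    by measurable
  show "fourier_integral g \<in> L2 lebesgue"
    unfolding L2_def using integrable_monotone_convergence[OF conv sq] F by simp
  have "(LINT \<xi>|lebesgue. (cmod (fourier_integral g \<xi>))\<^sup>2) = (2 * pi) ^ CARD('n) * (LINT x|lebesgue. (cmod (g x))\<^sup>2)"
    by (rule integral_monotone_convergence[OF conv sq])
  then show "L2_norm lebesgue (fourier_integral g) = sqrt ((2 * pi) ^ CARD('n)) * L2_norm lebesgue g"
    by (simp add: L2_norm_def real_sqrt_mult)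
qed

section \<open>Plancherel's identity on the intersection of L1 and L2\<close>

text \<open>A single majorant, integrable together with its square, gives convergence in both
  norms.\<close>

lemma L1_L2_dominated_tendsto:
  fixes s :: "nat \<Rightarrow> 'a \<Rightarrow> complex" and w :: "'a \<Rightarrow> real"
  assumes s [measurable]: "\<And>k. s k \<in> borel_measurable M" and f [measurable]: "f \<in> borel_measurable M"
    and w: "integrable M w" "integrable M (\<lambda>x. (w x)\<^sup>2)"
    and le: "\<And>k. AE x in M. cmod (s k x - f x) \<le> w x"
    and lim: "AE x in M. (\<lambda>k. s k x) \<longlonglongrightarrow> f x"
  shows "(\<lambda>k. L1_norm M (\<lambda>x. s k x - f x)) \<longlonglongrightarrow> 0"
    and "(\<lambda>k. L2_norm M (\<lambda>x. s k x - f x)) \<longlonglongrightarrow> 0"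
proof -
  have d: "AE x in M. (\<lambda>k. cmod (s k x - f x)) \<longlonglongrightarrow> 0"
    using lim by eventually_elim (intro tendsto_norm_zero LIM_zero)
  have "(\<lambda>k. LINT x|M. cmod (s k x - f x)) \<longlonglongrightarrow> (LINT x|M. 0)"
    by (rule integral_dominated_convergence[OF _ _ w(1) d]) (use le in auto)
  then show "(\<lambda>k. L1_norm M (\<lambda>x. s k x - f x)) \<longlonglongrightarrow> 0"
    by (simp add: L1_norm_def)
  have d2: "AE x in M. (\<lambda>k. (cmod (s k x - f x))\<^sup>2) \<longlonglongrightarrow> 0"
  proof (rule AE_mp[OF d], intro AE_I2 impI)
    fix x assume "(\<lambda>k. cmod (s k x - f x)) \<longlonglongrightarrow> 0"
    from tendsto_power[OF this, of 2] show "(\<lambda>k. (cmod (s k x - f x))\<^sup>2) \<longlonglongrightarrow> 0" by simp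
  qed
  have le2: "AE x in M. norm ((cmod (s k x - f x))\<^sup>2) \<le> (w x)\<^sup>2" for k
    using le[of k] by eventually_elim (auto intro!: power_mono)
  have "(\<lambda>k. LINT x|M. (cmod (s k x - f x))\<^sup>2) \<longlonglongrightarrow> (LINT x|M. 0)"
    by (rule integral_dominated_convergence[OF _ _ w(2) d2 le2]) simp_all
  from tendsto_real_sqrt[OF this]
  show "(\<lambda>k. L2_norm M (\<lambda>x. s k x - f x)) \<longlonglongrightarrow> 0"
    by (simp add: L2_norm_def)
qed

lemma L1_norm_diff_triangle:
  assumes "integrable M f" "integrable M g" "integrable M h"
  shows "L1_norm M (\<lambda>x. f x - h x) \<le> L1_norm M (\<lambda>x. f x - g x) + L1_norm M (\<lambda>x. g x - h x)"
proof -
  have "L1_norm M (\<lambda>x. f x - h x) \<le> (LINT x|M. cmod (f x - g x) + cmod (g x - h x))"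
    unfolding L1_norm_def
  proof (rule integral_mono)
    show "cmod (f x - h x) \<le> cmod (f x - g x) + cmod (g x - h x)" for x
      using norm_triangle_ineq[of "f x - g x" "g x - h x"] by simp
  qed (use assms in auto)
  also have "\<dots> = L1_norm M (\<lambda>x. f x - g x) + L1_norm M (\<lambda>x. g x - h x)"
    unfolding L1_norm_def using assms by (intro Bochner_Integration.integral_add) auto
  finally show ?thesis .
qed

text \<open>A measurable function is almost everywhere a limit of continuous functions. These need
  not be bounded or integrable, so they are modified to have a common bound and a common bounded
  support, in such a way that the limit does not change.\<close>

lemma bounded_support_approx:
  fixes g :: "'a::euclidean_space \<Rightarrow> complex"
  assumes g: "g \<in> borel_measurable lebesgue" and m: "m > 0"
    and le: "\<And>x. cmod (g x) \<le> m" and supp: "\<And>x. norm x > m \<Longrightarrow> g x = 0" and e: "e > 0"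
  obtains h where "continuous_on UNIV h" "integrable lebesgue h" "\<And>x. cmod (h x) \<le> m"
    "L1_norm lebesgue (\<lambda>x. h x - g x) < e" "L2_norm lebesgue (\<lambda>x. h x - g x) < e"
proof -
  have "g measurable_on UNIV"
    using g by (simp add: measurable_on_iff_borel_measurable lebesgue_on_UNIV_eq)
  then obtain N p where N: "negligible N" and p: "\<And>k::nat. continuous_on UNIV (p k)"
    and lim: "\<And>x. x \<notin> N \<Longrightarrow> (\<lambda>k. p k x) \<longlonglongrightarrow> g x"
    by (auto simp: measurable_on_def)
  \<comment> \<open>\<open>clamp\<close> is the radial retraction of the plane onto the disc of
    radius m, which contains the values of \<open>g\<close>. The cutoff \<phi> equals 1 where the
    norm is at most m, hence wherever \<open>g\<close> is nonzero, and vanishes where the norm is at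
    least m + 1.\<close>
  define clamp where "clamp z = complex_of_real (m / max m (cmod z)) * z" for z
  define \<phi> where "\<phi> x = max 0 (min 1 (m + 1 - norm x))" for x :: 'a
  define s where "s k x = clamp (p k x) * complex_of_real (\<phi> x)" for k x
  have clamp_cont: "continuous_on UNIV clamp"
    unfolding clamp_def using m by (intro continuous_intros) auto
  have \<phi>_cont: "continuous_on UNIV \<phi>"
    unfolding \<phi>_def by (intro continuous_intros)
  have s_cont: "continuous_on UNIV (s k)" for k
    unfolding s_def using continuous_on_compose2[OF clamp_cont p] \<phi>_cont
    by (intro continuous_intros) auto
  have clamp_le: "cmod (clamp z) \<le> m" for z
    using m by (auto simp: clamp_def norm_mult norm_divide field_simps max_def)
  have clamp_id: "clamp z = z" if "cmod z \<le> m" for z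
    using that m by (simp add: clamp_def max_def)
  have \<phi>: "0 \<le> \<phi> x" "\<phi> x \<le> 1" for x by (auto simp: \<phi>_def)
  have s_le: "cmod (s k x) \<le> m * indicator (cball 0 (m + 1)) x" for k x
  proof (cases "norm x \<le> m + 1")
    case True
    have "cmod (s k x) \<le> m * 1"
      unfolding s_def norm_mult using \<phi>[of x] m by (intro mult_mono clamp_le) auto
    with True show ?thesis by simp
  next
    case False
    then show ?thesis by (simp add: s_def \<phi>_def)
  qed
  have s_lim: "(\<lambda>k. s k x) \<longlonglongrightarrow> g x" if "x \<notin> N" for x
  proof -
    have "(\<lambda>k. clamp (p k x)) \<longlonglongrightarrow> clamp (g x)"
      using continuous_on_tendsto_compose[OF clamp_cont lim[OF that]] by simp
    then have "(\<lambda>k. s k x) \<longlonglongrightarrow> clamp (g x) * complex_of_real (\<phi> x)"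
      unfolding s_def by (intro tendsto_intros)
    moreover have "clamp (g x) * complex_of_real (\<phi> x) = g x"
      using supp[of x] clamp_id[OF le] by (cases "norm x > m") (auto simp: \<phi>_def clamp_def)
    ultimately show ?thesis by simp
  qed
  define w where "w x = 2 * m * indicator (cball 0 (m + 1)) x" for x :: 'a
  have int_ind: "integrable lebesgue (\<lambda>x::'a. indicator (cball 0 (m + 1)) x :: real)"
    using emeasure_lborel_cball_finite[of "0::'a" "m + 1"]
    by (intro integrable_real_indicator) (simp_all add: infinity_ennreal_def)
  have w: "integrable lebesgue w" "integrable lebesgue (\<lambda>x. (w x)\<^sup>2)"
    unfolding w_def power2_eq_square using int_ind
    by (auto simp: power2_eq_square mult_ac simp flip: indicator_inter_arith)
  have g_le: "cmod (g x) \<le> m * indicator (cball 0 (m + 1)) x" for x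
    using le[of x] supp[of x] m by (cases "norm x \<le> m + 1") auto
  have diff_le: "cmod (s k x - g x) \<le> w x" for k x
    using norm_triangle_ineq4[of "s k x" "g x"] s_le[of k x] g_le[of x] by (simp add: w_def)
  have s_meas: "s k \<in> borel_measurable lebesgue" for k
    using s_cont by (intro borel_measurable_imp_lebesgue borel_measurable_continuous_onI)
  have "AE x in lebesgue. x \<notin> N"
    using N by (simp add: negligible_iff_null_sets AE_not_in)
  then have AE_lim: "AE x in lebesgue. (\<lambda>k. s k x) \<longlonglongrightarrow> g x"
    by eventually_elim (rule s_lim)
  note conv = L1_L2_dominated_tendsto[OF s_meas g w AE_I2[OF diff_le] AE_lim]
  have "eventually (\<lambda>k. L1_norm lebesgue (\<lambda>x. s k x - g x) < e \<and> L2_norm lebesgue (\<lambda>x. s k x - g x) < e) sequentially"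
    using conv e by (intro eventually_conj order_tendstoD(2)) auto
  then obtain k where k: "L1_norm lebesgue (\<lambda>x. s k x - g x) < e" "L2_norm lebesgue (\<lambda>x. s k x - g x) < e"
    by (auto dest: eventually_happens)
  show thesis
  proof (rule that[OF s_cont _ _ k])
    show "integrable lebesgue (s k)"
      by (rule Bochner_Integration.integrable_bound[where f="\<lambda>x. m * indicator (cball 0 (m + 1)) x", OF _ s_meas])
        (use int_ind m in \<open>auto intro!: AE_I2 order_trans[OF s_le]\<close>)
    show "cmod (s k x) \<le> m" for x
      using s_le[of k x] m by (cases "norm x \<le> m + 1") auto
  qed
qed

lemma bounded_integrable_L2:
  assumes "integrable M h" "\<And>x. cmod (h x) \<le> B"
  shows "h \<in> L2 M"
proof -
  have "integrable M (\<lambda>x. complex_of_real (cmod (h x)) * h x)"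
    by (rule integrable_bounded_mult[OF assms(1), where B=B]) (use assms in auto)
  from integrable_norm[OF this] show ?thesis
    using assms(1) by (simp add: L2_def norm_mult power2_eq_square)
qed

text \<open>One approximant must be close in both norms at once: closeness in L1 makes the
  transforms close at every frequency, closeness in L2 makes them close in norm.\<close>

lemma continuous_approx:
  fixes g :: "'a::euclidean_space \<Rightarrow> complex"
  assumes g: "g \<in> L1 lebesgue" "g \<in> L2 lebesgue" and e: "e > 0"
  obtains h B where "continuous_on UNIV h" "integrable lebesgue h" "\<And>x. cmod (h x) \<le> B"
    "L1_norm lebesgue (\<lambda>x. h x - g x) < e" "L2_norm lebesgue (\<lambda>x. h x - g x) < e"
proof -
  have int: "integrable lebesgue g" using g by (simp add: L1_def)
  have [measurable]: "g \<in> borel_measurable lebesgue" using int by simp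
  \<comment> \<open>Cutting off both large values and distant points meets the conditions of
    \<open>bounded_support_approx\<close>; the level \<open>Suc k\<close> makes the required bound
    positive.\<close>
  define s where "s k x = (if cmod (g x) \<le> real (Suc k) \<and> norm x \<le> real (Suc k) then g x else 0)" for k x
  have nm [measurable]: "(\<lambda>x::'a. norm x) \<in> borel_measurable lebesgue"
    by (intro borel_measurable_imp_lebesgue) simp
  have s_meas [measurable]: "s k \<in> borel_measurable lebesgue" for k
    unfolding s_def[abs_def] by measurable
  have s_int: "integrable lebesgue (s k)" for k
    by (rule Bochner_Integration.integrable_bound[OF int s_meas]) (simp add: s_def)
  have s_lim: "(\<lambda>k. s k x) \<longlonglongrightarrow> g x" for x
  proof (rule tendsto_eventually)
    obtain K where K: "max (cmod (g x)) (norm x) \<le> real K"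
      using real_arch_simple by blast
    show "eventually (\<lambda>k. s k x = g x) sequentially"
      using eventually_ge_at_top[of K] by eventually_elim (use K in \<open>auto simp: s_def\<close>)
  qed
  have "(\<lambda>k. L1_norm lebesgue (\<lambda>x. s k x - g x)) \<longlonglongrightarrow> 0" "(\<lambda>k. L2_norm lebesgue (\<lambda>x. s k x - g x)) \<longlonglongrightarrow> 0"
    by (rule L1_L2_dominated_tendsto[where w="\<lambda>x. cmod (g x)"];
        use int L2_integrable[OF g(2)] s_lim in \<open>auto simp: s_def\<close>)+
  then have "eventually (\<lambda>k. L1_norm lebesgue (\<lambda>x. s k x - g x) < e/2 \<and> L2_norm lebesgue (\<lambda>x. s k x - g x) < e/2) sequentially"
    using e by (intro eventually_conj order_tendstoD(2)) auto
  then obtain k where k: "L1_norm lebesgue (\<lambda>x. s k x - g x) < e/2" "L2_norm lebesgue (\<lambda>x. s k x - g x) < e/2"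
    by (auto dest: eventually_happens)
  obtain h where h: "continuous_on UNIV h" "integrable lebesgue h" "\<And>x. cmod (h x) \<le> real (Suc k)"
    "L1_norm lebesgue (\<lambda>x. h x - s k x) < e/2" "L2_norm lebesgue (\<lambda>x. h x - s k x) < e/2"
    by (rule bounded_support_approx[OF s_meas, of "real (Suc k)" k "e/2"]) (use e in \<open>auto simp: s_def\<close>)
  have sL2: "s k \<in> L2 lebesgue"
    by (rule L2_bounded[OF g(2) s_meas, of _ 1]) (simp add: s_def)
  have hL2: "h \<in> L2 lebesgue"
    using h(2,3) by (rule bounded_integrable_L2)
  show thesis
  proof (rule that[OF h(1-3)])
    show "L1_norm lebesgue (\<lambda>x. h x - g x) < e"
      using L1_norm_diff_triangle[OF h(2) s_int int, of k] k(1) h(4) by simp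
    show "L2_norm lebesgue (\<lambda>x. h x - g x) < e"
      using L2_norm_diff_triangle[OF hL2 sL2 g(2)] k(2) h(5) by simp
  qed
qed

text \<open>L1 convergence identifies the pointwise limit of the transforms of the approximants as
  the transform of \<open>g\<close>; L2 convergence makes those transforms Cauchy, by the identity
  for differences of approximants. Fatou's lemma reconciles the two limits.\<close>

lemma Plancherel_L1_L2:
  fixes g :: "real ^ 'n \<Rightarrow> complex"
  assumes g: "g \<in> L1 lebesgue" "g \<in> L2 lebesgue"
  shows "fourier_integral g \<in> L2 lebesgue"
    and "L2_norm lebesgue (fourier_integral g) = sqrt ((2 * pi) ^ CARD('n)) * L2_norm lebesgue g"
proof -
  let ?c = "sqrt ((2 * pi) ^ CARD('n))"
  have int: "integrable lebesgue g" using g by (simp add: L1_def)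
  have "\<forall>k::nat. \<exists>h. continuous_on UNIV h \<and> integrable lebesgue h \<and> (\<exists>B. \<forall>x. cmod (h x) \<le> B) \<and>
      L1_norm lebesgue (\<lambda>x. h x - g x) < inverse (real (Suc k)) \<and> L2_norm lebesgue (\<lambda>x. h x - g x) < inverse (real (Suc k))"
  proof
    fix k
    have "inverse (real (Suc k)) > 0" by simp
    from continuous_approx[OF g this] obtain h B where "continuous_on UNIV h" "integrable lebesgue h"
      "\<And>x. cmod (h x) \<le> B" "L1_norm lebesgue (\<lambda>x. h x - g x) < inverse (real (Suc k))"
      "L2_norm lebesgue (\<lambda>x. h x - g x) < inverse (real (Suc k))"
      by blast
    then show "\<exists>h. continuous_on UNIV h \<and> integrable lebesgue h \<and> (\<exists>B. \<forall>x. cmod (h x) \<le> B) \<and>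
      L1_norm lebesgue (\<lambda>x. h x - g x) < inverse (real (Suc k)) \<and> L2_norm lebesgue (\<lambda>x. h x - g x) < inverse (real (Suc k))"
      by (intro exI[of _ h] conjI exI[of _ B]) auto
  qed
  from choice[OF this] obtain h where h: "\<And>k::nat. continuous_on UNIV (h k)" "\<And>k. integrable lebesgue (h k)"
      "\<And>k. \<exists>B. \<forall>x. cmod (h k x) \<le> B"
    and L1: "\<And>k::nat. L1_norm lebesgue (\<lambda>x. h k x - g x) < inverse (real (Suc k))"
    and L2: "\<And>k. L2_norm lebesgue (\<lambda>x. h k x - g x) < inverse (real (Suc k))"
    by auto
  note cont = h(1) and h_int = h(2)
  obtain B where bd: "\<And>k x. cmod (h k x) \<le> B k"
    using h(3) by metis
  have hL2: "h k \<in> L2 lebesgue" for k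
    using h_int bd by (rule bounded_integrable_L2)
  have F_meas: "fourier_integral g \<in> borel_measurable lebesgue"
    using int by (intro fourier_integral_measurable) simp
  have FL2: "fourier_integral (h k) \<in> L2 lebesgue" for k
    by (rule Plancherel_continuous(1)[OF h_int cont bd])
  have F_diff: "L2_norm lebesgue (\<lambda>\<xi>. fourier_integral (h j) \<xi> - fourier_integral (h k) \<xi>)
      = ?c * L2_norm lebesgue (\<lambda>x. h j x - h k x)" for j k
  proof -
    have "L2_norm lebesgue (fourier_integral (\<lambda>x. h j x - h k x)) = ?c * L2_norm lebesgue (\<lambda>x. h j x - h k x)"
    proof (rule Plancherel_continuous(2))
      show "cmod (h j x - h k x) \<le> B j + B k" for x
        using norm_triangle_ineq4[of "h j x" "h k x"] bd[of j x] bd[of k x] by linarith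
    qed (auto intro!: continuous_intros cont h_int)
    then show ?thesis
      unfolding fourier_integral_diff[OF h_int[of j] h_int[of k], abs_def] .
  qed
  have F_lim: "(\<lambda>k. fourier_integral (h k) \<xi>) \<longlonglongrightarrow> fourier_integral g \<xi>" for \<xi>
  proof (rule LIM_zero_cancel, rule Lim_null_comparison[OF _ LIMSEQ_inverse_real_of_nat])
    show "\<forall>\<^sub>F k in sequentially. norm (fourier_integral (h k) \<xi> - fourier_integral g \<xi>) \<le> inverse (real (Suc k))"
    proof (rule always_eventually, rule allI)
      fix k
      show "norm (fourier_integral (h k) \<xi> - fourier_integral g \<xi>) \<le> inverse (real (Suc k))"
        using fourier_integral_bound[of "\<lambda>x. h k x - g x" \<xi>] L1[of k]
        by (simp add: fourier_integral_diff[OF h_int int])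
    qed
  qed
  \<comment> \<open>With j fixed and k at least j, the approximants differ in L2 by at most 1/(j+1)
    + 1/(k+1), which the factor 2 absorbs. The bound survives as k tends to infinity.\<close>
  have F_approx: "(\<lambda>\<xi>. fourier_integral (h j) \<xi> - fourier_integral g \<xi>) \<in> L2 lebesgue"
    "L2_norm lebesgue (\<lambda>\<xi>. fourier_integral (h j) \<xi> - fourier_integral g \<xi>) \<le> ?c * (2 * inverse (real (Suc j)))" for j
  proof -
    have ev: "\<forall>\<^sub>F k in sequentially. L2_norm lebesgue (\<lambda>\<xi>. fourier_integral (h j) \<xi> - fourier_integral (h k) \<xi>)
        \<le> ?c * (2 * inverse (real (Suc j)))"
      using eventually_ge_at_top[of j]
    proof eventually_elim
      case (elim k)
      have "L2_norm lebesgue (\<lambda>x. h j x - h k x) \<le> L2_norm lebesgue (\<lambda>x. h j x - g x) + L2_norm lebesgue (\<lambda>x. g x - h k x)"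
        by (rule L2_norm_diff_triangle[OF hL2 g(2) hL2])
      also have "\<dots> \<le> inverse (real (Suc j)) + inverse (real (Suc k))"
        using L2[of j] L2[of k] L2_norm_minus_commute[of lebesgue g "h k"] by simp
      also have "\<dots> \<le> 2 * inverse (real (Suc j))"
        using elim le_imp_inverse_le[of "real (Suc j)" "real (Suc k)"] by simp
      finally show ?case
        unfolding F_diff by (intro mult_left_mono) auto
    qed
    have AE: "AE \<xi> in lebesgue. (\<lambda>k. fourier_integral (h j) \<xi> - fourier_integral (h k) \<xi>)
        \<longlonglongrightarrow> fourier_integral (h j) \<xi> - fourier_integral g \<xi>"
      by (intro AE_I2 tendsto_intros F_lim)
    have meas: "(\<lambda>\<xi>. fourier_integral (h j) \<xi> - fourier_integral g \<xi>) \<in> borel_measurable lebesgue"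
      using F_meas L2_measurable[OF FL2] by measurable
    show "(\<lambda>\<xi>. fourier_integral (h j) \<xi> - fourier_integral g \<xi>) \<in> L2 lebesgue"
      "L2_norm lebesgue (\<lambda>\<xi>. fourier_integral (h j) \<xi> - fourier_integral g \<xi>) \<le> ?c * (2 * inverse (real (Suc j)))"
      by (rule L2_Fatou[OF L2_diff[OF FL2 FL2] meas AE ev])+
  qed
  have "(\<lambda>\<xi>. fourier_integral (h 0) \<xi> - (fourier_integral (h 0) \<xi> - fourier_integral g \<xi>)) \<in> L2 lebesgue"
    by (rule L2_diff[OF FL2 F_approx(1)])
  then show Fg: "fourier_integral g \<in> L2 lebesgue" by simp
  have inv: "(\<lambda>j. ?c * (2 * inverse (real (Suc j)))) \<longlonglongrightarrow> 0"
    using tendsto_mult_right_zero[OF tendsto_mult_right_zero[OF LIMSEQ_inverse_real_of_nat]] by simp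
  have "(\<lambda>j. L2_norm lebesgue (\<lambda>\<xi>. fourier_integral (h j) \<xi> - fourier_integral g \<xi>)) \<longlonglongrightarrow> 0"
    by (rule Lim_null_comparison[OF _ inv]) (use F_approx(2) in simp)
  then have lim1: "(\<lambda>j. L2_norm lebesgue (fourier_integral (h j))) \<longlonglongrightarrow> L2_norm lebesgue (fourier_integral g)"
    by (rule L2_norm_tendsto[OF FL2 Fg])
  have "(\<lambda>j. L2_norm lebesgue (\<lambda>x. h j x - g x)) \<longlonglongrightarrow> 0"
    by (rule Lim_null_comparison[OF _ LIMSEQ_inverse_real_of_nat]) (use L2 in \<open>simp add: less_imp_le\<close>)
  then have "(\<lambda>j. ?c * L2_norm lebesgue (h j)) \<longlonglongrightarrow> ?c * L2_norm lebesgue g"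
    by (intro tendsto_intros L2_norm_tendsto[OF hL2 g(2)])
  then have lim2: "(\<lambda>j. L2_norm lebesgue (fourier_integral (h j))) \<longlonglongrightarrow> ?c * L2_norm lebesgue g"
    unfolding Plancherel_continuous(2)[OF h_int cont bd] .
  show "L2_norm lebesgue (fourier_integral g) = ?c * L2_norm lebesgue g"
    by (rule LIMSEQ_unique[OF lim1 lim2])
qed

section \<open>The Fourier transform on L2\<close>

definition truncate :: "real \<Rightarrow> (real ^ 'n \<Rightarrow> complex) \<Rightarrow> real ^ 'n \<Rightarrow> complex" where
  "truncate R g x = indicator (ball 0 R) x * g x"

text \<open>A truncation is the product of \<open>g\<close> with the indicator of a ball, which is
  itself square integrable; it is therefore integrable and its Fourier integral converges
  absolutely.\<close>

lemma
  fixes g :: "real ^ 'n \<Rightarrow> complex"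
  assumes g: "g \<in> L2 lebesgue"
  shows truncate_L2: "truncate R g \<in> L2 lebesgue"
    and truncate_L1: "truncate R g \<in> L1 lebesgue"
proof -
  have [measurable]: "g \<in> borel_measurable lebesgue"
    using g by (rule L2_measurable)
  have [measurable]: "ball (0::real^'n) R \<in> sets lebesgue"
    by simp
  have "truncate R g \<in> borel_measurable lebesgue"
    unfolding truncate_def[abs_def] by measurable
  from L2_bounded[OF g this, of 1] show "truncate R g \<in> L2 lebesgue"
    by (simp add: truncate_def indicator_def)
  have "integrable lebesgue (\<lambda>x::real^'n. indicator (ball 0 R) x :: real)"
    using emeasure_lborel_ball_finite[of "0::real^'n" R]
    by (intro integrable_real_indicator) (simp_all add: infinity_ennreal_def)
  moreover have "(cmod (indicator (ball 0 R) x))\<^sup>2 = indicator (ball 0 R) x" for x :: "real^'n"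
    by (simp add: indicator_def)
  ultimately have "(\<lambda>x::real^'n. indicator (ball 0 R) x) \<in> L2 lebesgue"
    by (simp add: L2_def)
  from L2_mult_integrable[OF this g] show "truncate R g \<in> L1 lebesgue"
    by (simp add: L1_def truncate_def[abs_def])
qed

lemma truncate_integrable: "g \<in> L2 lebesgue \<Longrightarrow> integrable lebesgue (truncate R g)"
  using truncate_L1[of g R] by (simp add: L1_def)

lemma truncate_tendsto:
  fixes g :: "real ^ 'n \<Rightarrow> complex"
  assumes g: "g \<in> L2 lebesgue"
  shows "((\<lambda>R. L2_norm lebesgue (\<lambda>x. truncate R g x - g x)) \<longlongrightarrow> 0) at_top"
proof -
  have [measurable]: "g \<in> borel_measurable lebesgue"
    using g by (rule L2_measurable)
  have [measurable]: "truncate R g \<in> borel_measurable lebesgue" for R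
    using truncate_L2[OF g] by (rule L2_measurable)
  have "((\<lambda>R. LINT x|lebesgue. (cmod (truncate R g x - g x))\<^sup>2) \<longlongrightarrow> (LINT x::real^'n|lebesgue. 0)) at_top"
  proof (rule integral_dominated_convergence_at_top)
    show "integrable lebesgue (\<lambda>x. (cmod (g x))\<^sup>2)"
      using g by (rule L2_integrable)
    show "AE x in lebesgue. ((\<lambda>R. (cmod (truncate R g x - g x))\<^sup>2) \<longlongrightarrow> 0) at_top"
    proof (intro AE_I2 tendsto_eventually)
      fix x
      show "\<forall>\<^sub>F R in at_top. (cmod (truncate R g x - g x))\<^sup>2 = 0"
        using eventually_gt_at_top[of "norm x"] by eventually_elim (simp add: truncate_def)
    qed
    show "\<forall>\<^sub>F R in at_top. AE x in lebesgue. norm ((cmod (truncate R g x - g x))\<^sup>2) \<le> (cmod (g x))\<^sup>2"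
      by (intro always_eventually allI AE_I2) (auto simp: truncate_def indicator_def)
  qed measurable
  from tendsto_real_sqrt[OF this] show ?thesis
    by (simp add: L2_norm_def)
qed

section \<open>Lebesgue measure against the frequency measure\<close>

lemma borel_measurable_freq [simp]: "borel_measurable freq_measure = borel_measurable lebesgue"
  by (intro measurable_cong_sets) (simp_all add: freq_measure_def)

lemma nn_integral_freq:
  fixes f :: "real ^ 'n \<Rightarrow> ennreal"
  assumes "f \<in> borel_measurable lebesgue"
  shows "(\<integral>\<^sup>+x. f x \<partial>freq_measure) = ennreal (1 / (2 * pi) ^ CARD('n)) * (\<integral>\<^sup>+x. f x \<partial>lebesgue)"
  unfolding freq_measure_def using assms
  by (simp add: nn_integral_density nn_integral_cmult)

lemma L2_freq: "L2 (freq_measure :: (real ^ 'n) measure) = L2 lebesgue"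
proof (rule set_eqI)
  fix f :: "real ^ 'n \<Rightarrow> complex"
  show "f \<in> L2 freq_measure \<longleftrightarrow> f \<in> L2 lebesgue"
  proof (cases "f \<in> borel_measurable lebesgue")
    case True
    then have "(\<lambda>x. ennreal ((cmod (f x))\<^sup>2)) \<in> borel_measurable lebesgue" by measurable
    then show ?thesis
      by (auto simp: L2_iff nn_integral_freq ennreal_mult_less_top)
  qed (simp add: L2_def)
qed

lemma L2_norm_freq:
  fixes f :: "real ^ 'n \<Rightarrow> complex"
  assumes "f \<in> borel_measurable lebesgue"
  shows "(L2_norm freq_measure f)\<^sup>2 = (L2_norm lebesgue f)\<^sup>2 / (2 * pi) ^ CARD('n)"
proof -
  have "(\<lambda>x. (cmod (f x))\<^sup>2) \<in> borel_measurable lebesgue"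
    using assms by measurable
  then show ?thesis
    unfolding L2_norm_power2 freq_measure_def by (subst integral_density) auto
qed

lemma fourier_truncate_L2:
  "g \<in> L2 lebesgue \<Longrightarrow> fourier_integral (truncate R g) \<in> L2 lebesgue"
  by (intro Plancherel_L1_L2(1) truncate_L1 truncate_L2)

text \<open>The transforms of truncations are square integrable, so for \<open>g\<close> and
  \<open>G\<close> in L2 the nonnegative integral in the definition is finite and is a fixed
  positive multiple of a squared norm. Real-valued limits then suffice.\<close>

lemma has_fourier_transform_iff:
  fixes g :: "real ^ 'n \<Rightarrow> complex"
  shows "has_fourier_transform g G \<longleftrightarrow> g \<in> L2 lebesgue \<and> G \<in> L2 lebesgue \<and>
    ((\<lambda>R. L2_norm lebesgue (\<lambda>\<xi>. fourier_integral (truncate R g) \<xi> - G \<xi>)) \<longlongrightarrow> 0) at_top"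
proof (cases "g \<in> L2 lebesgue \<and> G \<in> L2 lebesgue")
  case True
  then have g: "g \<in> L2 lebesgue" and G: "G \<in> L2 lebesgue" by auto
  let ?p = "(2 * pi) ^ CARD('n)"
  let ?d = "\<lambda>R \<xi>. fourier_integral (truncate R g) \<xi> - G \<xi>"
  let ?n = "\<lambda>R. L2_norm lebesgue (?d R)"
  have d: "?d R \<in> L2 lebesgue" for R
    by (intro L2_diff fourier_truncate_L2 g G)
  have "(\<integral>\<^sup>+ \<xi>. ennreal ((cmod (?d R \<xi>))\<^sup>2) \<partial>freq_measure) = ennreal (1 / ?p * (?n R)\<^sup>2)" for R
  proof -
    have "(\<lambda>\<xi>. ennreal ((cmod (?d R \<xi>))\<^sup>2)) \<in> borel_measurable lebesgue"
      using L2_measurable[OF d[of R]] by measurable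
    then show ?thesis
      by (simp add: nn_integral_freq nn_integral_L2[OF d] ennreal_mult'[symmetric])
  qed
  then have "has_fourier_transform g G \<longleftrightarrow> ((\<lambda>R. ennreal (1 / ?p * (?n R)\<^sup>2)) \<longlongrightarrow> ennreal 0) at_top"
    using g G by (simp add: has_fourier_transform_def L2_freq truncate_def[abs_def])
  also have "\<dots> \<longleftrightarrow> ((\<lambda>R. 1 / ?p * (?n R)\<^sup>2) \<longlongrightarrow> 0) at_top"
    by (rule tendsto_ennreal_iff) auto
  also have "\<dots> \<longleftrightarrow> (?n \<longlongrightarrow> 0) at_top"
  proof
    assume "((\<lambda>R. 1 / ?p * (?n R)\<^sup>2) \<longlongrightarrow> 0) at_top"
    from tendsto_real_sqrt[OF tendsto_mult[OF tendsto_const[of ?p] this]]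
    show "(?n \<longlongrightarrow> 0) at_top" by simp
  next
    assume "(?n \<longlongrightarrow> 0) at_top"
    from tendsto_mult[OF tendsto_const[of "1 / ?p"] tendsto_power[OF this, of 2]]
    show "((\<lambda>R. 1 / ?p * (?n R)\<^sup>2) \<longlongrightarrow> 0) at_top" by simp
  qed
  finally show ?thesis using g G by simp
qed (auto simp: has_fourier_transform_def L2_freq)

lemma Plancherel_diff:
  fixes f g :: "real ^ 'n \<Rightarrow> complex"
  assumes f: "f \<in> L1 lebesgue" "f \<in> L2 lebesgue" and g: "g \<in> L1 lebesgue" "g \<in> L2 lebesgue"
  shows "L2_norm lebesgue (\<lambda>\<xi>. fourier_integral f \<xi> - fourier_integral g \<xi>)
      = sqrt ((2 * pi) ^ CARD('n)) * L2_norm lebesgue (\<lambda>x. f x - g x)"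
proof -
  have int: "integrable lebesgue f" "integrable lebesgue g" using f g by (auto simp: L1_def)
  have "(\<lambda>x. f x - g x) \<in> L1 lebesgue" using int by (simp add: L1_def)
  from Plancherel_L1_L2(2)[OF this L2_diff[OF f(2) g(2)]] show ?thesis
    unfolding fourier_integral_diff[OF int, abs_def] .
qed

text \<open>This consistency makes the L1 bound on Fourier integrals available for the chosen
  representative \<open>fourier g\<close>.\<close>

lemma has_fourier_transform_fourier_integral:
  fixes g :: "real ^ 'n \<Rightarrow> complex"
  assumes g: "g \<in> L1 lebesgue" "g \<in> L2 lebesgue"
  shows "has_fourier_transform g (fourier_integral g)"
proof -
  have "((\<lambda>R. sqrt ((2 * pi) ^ CARD('n)) * L2_norm lebesgue (\<lambda>x. truncate R g x - g x)) \<longlongrightarrow> 0) at_top"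
    using tendsto_mult_right_zero[OF truncate_tendsto[OF g(2)]] .
  then show ?thesis
    unfolding has_fourier_transform_iff
    using g Plancherel_L1_L2(1)[OF g]
    by (simp add: Plancherel_diff[OF truncate_L1[OF g(2)] truncate_L2[OF g(2)] g])
qed

text \<open>Completeness is a statement about sequences, so the limit is built along integer radii
  and the remaining radii are compared with it afterwards.\<close>

lemma has_fourier_transform_exists:
  fixes g :: "real ^ 'n \<Rightarrow> complex"
  assumes g: "g \<in> L2 lebesgue"
  shows "\<exists>G. has_fourier_transform g G"
proof -
  let ?c = "sqrt ((2 * pi) ^ CARD('n))"
  let ?F = "\<lambda>R. fourier_integral (truncate R g)"
  let ?n = "\<lambda>R. L2_norm lebesgue (\<lambda>x. truncate R g x - g x)"
  have F: "?F R \<in> L2 lebesgue" for R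
    by (rule fourier_truncate_L2[OF g])
  have c: "?c > 0" by simp
  have F_le: "L2_norm lebesgue (\<lambda>\<xi>. ?F R \<xi> - ?F S \<xi>) \<le> ?c * (?n R + ?n S)" for R S
  proof -
    have "L2_norm lebesgue (\<lambda>x. truncate R g x - truncate S g x) \<le> ?n R + ?n S"
      using L2_norm_diff_triangle[OF truncate_L2[OF g, of R] g truncate_L2[OF g, of S]]
        L2_norm_minus_commute[of lebesgue g "truncate S g"] by simp
    then show ?thesis
      unfolding Plancherel_diff[OF truncate_L1[OF g] truncate_L2[OF g] truncate_L1[OF g] truncate_L2[OF g]]
      by (intro mult_left_mono) auto
  qed
  have n_lim: "(\<lambda>k. ?n (real k)) \<longlonglongrightarrow> 0"
    by (rule filterlim_compose[OF truncate_tendsto[OF g] filterlim_real_sequentially])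
  have "\<exists>N. \<forall>j\<ge>N. \<forall>k\<ge>N. L2_norm lebesgue (\<lambda>\<xi>. ?F (real j) \<xi> - ?F (real k) \<xi>) \<le> e" if e: "e > 0" for e
  proof -
    have "e / (2 * ?c) > 0" using e c by simp
    from order_tendstoD(2)[OF n_lim this] obtain N where N: "\<And>k. k \<ge> N \<Longrightarrow> ?n (real k) < e / (2 * ?c)"
      unfolding eventually_sequentially by blast
    have "?c * (?n (real j) + ?n (real k)) \<le> e" if "j \<ge> N" "k \<ge> N" for j k
    proof -
      have "?c * (?n (real j) + ?n (real k)) \<le> ?c * (e / (2 * ?c) + e / (2 * ?c))"
        using N[OF that(1)] N[OF that(2)] by (intro mult_left_mono add_mono) auto
      also have "\<dots> = e" using c by (simp add: field_simps)
      finally show ?thesis .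
    qed
    then show ?thesis
      using order_trans[OF F_le] by blast
  qed
  from L2_complete[of "\<lambda>k. ?F (real k)", OF F this] obtain G where G: "G \<in> L2 lebesgue"
    and G_lim: "(\<lambda>k. L2_norm lebesgue (\<lambda>\<xi>. ?F (real k) \<xi> - G \<xi>)) \<longlonglongrightarrow> 0"
    by blast
  \<comment> \<open>The triangle inequality through the integer radius k holds for every k; letting
    k tend to infinity leaves a bound that depends only on \<open>R\<close>.\<close>
  have "L2_norm lebesgue (\<lambda>\<xi>. ?F R \<xi> - G \<xi>) \<le> ?c * ?n R" for R
  proof (rule tendsto_lowerbound)
    have "(\<lambda>k. ?c * (?n R + ?n (real k)) + L2_norm lebesgue (\<lambda>\<xi>. ?F (real k) \<xi> - G \<xi>)) \<longlonglongrightarrow> ?c * (?n R + 0) + 0"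
      by (intro tendsto_intros n_lim G_lim)
    then show "(\<lambda>k. ?c * (?n R + ?n (real k)) + L2_norm lebesgue (\<lambda>\<xi>. ?F (real k) \<xi> - G \<xi>)) \<longlonglongrightarrow> ?c * ?n R"
      by simp
    show "\<forall>\<^sub>F k in sequentially. L2_norm lebesgue (\<lambda>\<xi>. ?F R \<xi> - G \<xi>)
        \<le> ?c * (?n R + ?n (real k)) + L2_norm lebesgue (\<lambda>\<xi>. ?F (real k) \<xi> - G \<xi>)"
    proof (rule always_eventually, rule allI)
      fix k
      show "L2_norm lebesgue (\<lambda>\<xi>. ?F R \<xi> - G \<xi>)
        \<le> ?c * (?n R + ?n (real k)) + L2_norm lebesgue (\<lambda>\<xi>. ?F (real k) \<xi> - G \<xi>)"
        using L2_norm_diff_triangle[OF F[of R] F[of "real k"] G] F_le[of R "real k"] by linarith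
    qed
  qed simp
  then have "\<forall>\<^sub>F R in at_top. norm (L2_norm lebesgue (\<lambda>\<xi>. ?F R \<xi> - G \<xi>)) \<le> ?c * ?n R"
    by simp
  from Lim_null_comparison[OF this tendsto_mult_right_zero[OF truncate_tendsto[OF g]]]
  show ?thesis
    unfolding has_fourier_transform_iff using g G by blast
qed

lemma has_fourier_transform_isometry:
  fixes g :: "real ^ 'n \<Rightarrow> complex"
  assumes "has_fourier_transform g G"
  shows "L2_norm lebesgue G = sqrt ((2 * pi) ^ CARD('n)) * L2_norm lebesgue g"
proof (rule tendsto_unique[OF trivial_limit_at_top_linorder])
  have g: "g \<in> L2 lebesgue" and G: "G \<in> L2 lebesgue"
    and lim: "((\<lambda>R. L2_norm lebesgue (\<lambda>\<xi>. fourier_integral (truncate R g) \<xi> - G \<xi>)) \<longlongrightarrow> 0) at_top"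
    using assms by (auto simp: has_fourier_transform_iff)
  show "((\<lambda>R. L2_norm lebesgue (fourier_integral (truncate R g))) \<longlongrightarrow> L2_norm lebesgue G) at_top"
    by (rule L2_norm_tendsto[OF fourier_truncate_L2[OF g] G lim])
  show "((\<lambda>R. L2_norm lebesgue (fourier_integral (truncate R g)))
      \<longlongrightarrow> sqrt ((2 * pi) ^ CARD('n)) * L2_norm lebesgue g) at_top"
    unfolding Plancherel_L1_L2(2)[OF truncate_L1[OF g] truncate_L2[OF g]]
    by (intro tendsto_mult tendsto_const L2_norm_tendsto[OF truncate_L2[OF g] g truncate_tendsto[OF g]])
qed

lemma has_fourier_transform_unique:
  fixes g :: "real ^ 'n \<Rightarrow> complex"
  assumes G: "has_fourier_transform g G" and H: "has_fourier_transform g H"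
  shows "AE \<xi> in lebesgue. G \<xi> = H \<xi>"
proof -
  let ?F = "\<lambda>R. fourier_integral (truncate R g)"
  have g: "g \<in> L2 lebesgue" and L2: "G \<in> L2 lebesgue" "H \<in> L2 lebesgue"
    and lim: "((\<lambda>R. L2_norm lebesgue (\<lambda>\<xi>. ?F R \<xi> - G \<xi>)) \<longlongrightarrow> 0) at_top"
      "((\<lambda>R. L2_norm lebesgue (\<lambda>\<xi>. ?F R \<xi> - H \<xi>)) \<longlongrightarrow> 0) at_top"
    using G H by (auto simp: has_fourier_transform_iff)
  have "L2_norm lebesgue (\<lambda>\<xi>. G \<xi> - H \<xi>) \<le> 0"
  proof (rule tendsto_lowerbound[OF _ _ trivial_limit_at_top_linorder])
    show "((\<lambda>R. L2_norm lebesgue (\<lambda>\<xi>. ?F R \<xi> - G \<xi>) + L2_norm lebesgue (\<lambda>\<xi>. ?F R \<xi> - H \<xi>)) \<longlongrightarrow> 0) at_top"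
      using tendsto_add[OF lim] by simp
    show "\<forall>\<^sub>F R in at_top. L2_norm lebesgue (\<lambda>\<xi>. G \<xi> - H \<xi>)
        \<le> L2_norm lebesgue (\<lambda>\<xi>. ?F R \<xi> - G \<xi>) + L2_norm lebesgue (\<lambda>\<xi>. ?F R \<xi> - H \<xi>)"
    proof (rule always_eventually, rule allI)
      fix R
      show "L2_norm lebesgue (\<lambda>\<xi>. G \<xi> - H \<xi>)
        \<le> L2_norm lebesgue (\<lambda>\<xi>. ?F R \<xi> - G \<xi>) + L2_norm lebesgue (\<lambda>\<xi>. ?F R \<xi> - H \<xi>)"
        using L2_norm_diff_triangle[OF L2(1) fourier_truncate_L2[OF g, of R] L2(2)]
          L2_norm_minus_commute[of lebesgue G "?F R"] by simp
    qed
  qed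
  then have "L2_norm lebesgue (\<lambda>\<xi>. G \<xi> - H \<xi>) = 0"
    by (simp add: order_antisym)
  from L2_norm_zero_AE[OF L2_diff[OF L2] this] show ?thesis
    by simp
qed

lemma has_fourier_transform_cong:
  fixes g :: "real ^ 'n \<Rightarrow> complex"
  assumes G: "has_fourier_transform g G" and H: "H \<in> L2 lebesgue"
    and AE: "AE \<xi> in lebesgue. G \<xi> = H \<xi>"
  shows "has_fourier_transform g H"
proof -
  have g: "g \<in> L2 lebesgue" and "G \<in> L2 lebesgue"
    using G by (auto simp: has_fourier_transform_iff)
  then have "L2_norm lebesgue (\<lambda>\<xi>. fourier_integral (truncate R g) \<xi> - G \<xi>)
      = L2_norm lebesgue (\<lambda>\<xi>. fourier_integral (truncate R g) \<xi> - H \<xi>)" for R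
    using AE by (intro L2_norm_cong_AE L2_measurable L2_diff fourier_truncate_L2 H) auto
  with G H show ?thesis
    by (simp add: has_fourier_transform_iff)
qed

text \<open>The Fourier kernel is symmetric, so the transform is its own transpose for the pairing
  without conjugation. Fubini shows this on truncations, and continuity of the pairing extends
  it.\<close>

lemma fourier_multiplication:
  fixes f h :: "real ^ 'n \<Rightarrow> complex"
  assumes F: "has_fourier_transform f F" and H: "has_fourier_transform h H"
  shows "(LINT \<xi>|lebesgue. F \<xi> * h \<xi>) = (LINT x|lebesgue. f x * H x)"
proof (rule tendsto_unique[OF trivial_limit_at_top_linorder])
  have f: "f \<in> L2 lebesgue" and F2: "F \<in> L2 lebesgue" and h: "h \<in> L2 lebesgue" and H2: "H \<in> L2 lebesgue"
    and limF: "((\<lambda>R. L2_norm lebesgue (\<lambda>\<xi>. fourier_integral (truncate R f) \<xi> - F \<xi>)) \<longlongrightarrow> 0) at_top"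
    and limH: "((\<lambda>R. L2_norm lebesgue (\<lambda>\<xi>. fourier_integral (truncate R h) \<xi> - H \<xi>)) \<longlongrightarrow> 0) at_top"
    using F H by (auto simp: has_fourier_transform_iff)
  have eq: "(LINT \<xi>|lebesgue. fourier_integral (truncate R f) \<xi> * truncate R h \<xi>)
      = (LINT x|lebesgue. truncate R f x * fourier_integral (truncate R h) x)" for R
    using fourier_Fubini[OF truncate_integrable[OF h, of R] truncate_integrable[OF f, of R], of "-1"]
    by (simp add: fourier_integral_cis inner_commute mult.commute)
  show "((\<lambda>R. LINT \<xi>|lebesgue. fourier_integral (truncate R f) \<xi> * truncate R h \<xi>)
      \<longlongrightarrow> (LINT \<xi>|lebesgue. F \<xi> * h \<xi>)) at_top"
    by (rule L2_mult_tendsto[OF fourier_truncate_L2[OF f] truncate_L2[OF h] F2 h limF truncate_tendsto[OF h]])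
  show "((\<lambda>R. LINT \<xi>|lebesgue. fourier_integral (truncate R f) \<xi> * truncate R h \<xi>)
      \<longlongrightarrow> (LINT x|lebesgue. f x * H x)) at_top"
    unfolding eq
    by (rule L2_mult_tendsto[OF truncate_L2[OF f] fourier_truncate_L2[OF h] f H2 truncate_tendsto[OF f] limH])
qed

text \<open>
  The candidate preimage \<open>g\<close> is the adjoint of the Fourier transform applied to \<open>G\<close>. Since the
  adjoint is, up to conjugation, the Fourier transform itself, it is isometric up to a factor as
  well, and expanding the square shows that the transform of \<open>g\<close> has distance 0 from \<open>G\<close>.
\<close>

lemma has_fourier_transform_surj:
  fixes G :: "real ^ 'n \<Rightarrow> complex"
  assumes G: "G \<in> L2 lebesgue"
  shows "\<exists>g. has_fourier_transform g G"
proof -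
  define p :: real where "p = (2 * pi) ^ CARD('n)"
  have p: "p > 0" by (simp add: p_def)
  obtain H where H: "has_fourier_transform (\<lambda>\<xi>. cnj (G \<xi>)) H"
    using has_fourier_transform_exists[OF L2_cnj[OF G]] by blast
  then have H2: "H \<in> L2 lebesgue" by (simp add: has_fourier_transform_iff)
  have nH: "(L2_norm lebesgue H)\<^sup>2 = p * (L2_norm lebesgue G)\<^sup>2"
    using p by (simp add: has_fourier_transform_isometry[OF H, folded p_def] L2_norm_cnj power_mult_distrib)
  \<comment> \<open>Formally this is the inverse transform of \<open>G\<close>: conjugating before
    and after reverses the sign of the phase, and 1 / p is the inversion constant (2
    pi)^(-n).\<close>
  define g where "g x = complex_of_real (1 / p) * cnj (H x)" for x
  have g: "g \<in> L2 lebesgue"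
    unfolding g_def by (intro L2_cmult L2_cnj H2)
  obtain K where K: "has_fourier_transform g K"
    using has_fourier_transform_exists[OF g] by blast
  then have K2: "K \<in> L2 lebesgue" by (simp add: has_fourier_transform_iff)
  have "L2_norm lebesgue g = 1 / p * L2_norm lebesgue H"
    unfolding g_def L2_norm_cmult L2_norm_cnj norm_of_real using p by simp
  then have "(L2_norm lebesgue g)\<^sup>2 = (L2_norm lebesgue G)\<^sup>2 / p"
    using p by (simp only: power_mult_distrib nH) (simp add: power2_eq_square)
  then have nK: "(L2_norm lebesgue K)\<^sup>2 = (L2_norm lebesgue G)\<^sup>2"
    using p by (simp add: has_fourier_transform_isometry[OF K, folded p_def] power_mult_distrib)
  \<comment> \<open>Transposition replaces the unknown \<open>K\<close> by the explicit
    \<open>g\<close>, so that the pairing becomes the squared norm of \<open>H\<close> divided by p.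
    The isometry evaluates this as the squared norm of \<open>G\<close>.\<close>
  have "(LINT \<xi>|lebesgue. K \<xi> * cnj (G \<xi>)) = (LINT x|lebesgue. g x * H x)"
    by (rule fourier_multiplication[OF K H])
  also have "\<dots> = (LINT x|lebesgue. complex_of_real (1 / p) * complex_of_real ((cmod (H x))\<^sup>2))"
    by (simp only: g_def complex_norm_square mult_ac)
  also have "\<dots> = complex_of_real (1 / p * (L2_norm lebesgue H)\<^sup>2)"
    by (simp only: integral_mult_right_zero integral_complex_of_real of_real_mult L2_norm_power2)
  also have "\<dots> = complex_of_real ((L2_norm lebesgue G)\<^sup>2)"
    using p nH by simp
  finally have inner: "(LINT \<xi>|lebesgue. K \<xi> * cnj (G \<xi>)) = complex_of_real ((L2_norm lebesgue G)\<^sup>2)" .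
  have KG: "integrable lebesgue (\<lambda>\<xi>. K \<xi> * cnj (G \<xi>))"
    by (rule L2_mult_integrable[OF K2 L2_cnj[OF G]])
  have "(L2_norm lebesgue (\<lambda>\<xi>. K \<xi> - G \<xi>))\<^sup>2
      = (LINT \<xi>|lebesgue. (cmod (K \<xi>))\<^sup>2 + (cmod (G \<xi>))\<^sup>2 - 2 * Re (K \<xi> * cnj (G \<xi>)))"
    unfolding L2_norm_power2
    unfolding cmod_power2
    by (intro Bochner_Integration.integral_cong refl) (simp add: power2_eq_square algebra_simps)
  also have "\<dots> = (L2_norm lebesgue K)\<^sup>2 + (L2_norm lebesgue G)\<^sup>2 - 2 * Re (LINT \<xi>|lebesgue. K \<xi> * cnj (G \<xi>))"
    unfolding L2_norm_power2 integral_Re[OF KG, symmetric]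
    using L2_integrable[OF K2] L2_integrable[OF G] integrable_Re[OF KG] by (simp del: times_complex.sel)
  also have "\<dots> = 0"
    unfolding inner nK by simp
  finally have "L2_norm lebesgue (\<lambda>\<xi>. K \<xi> - G \<xi>) = 0" by simp
  from L2_norm_zero_AE[OF L2_diff[OF K2 G] this] have "AE \<xi> in lebesgue. K \<xi> = G \<xi>"
    by simp
  with has_fourier_transform_cong[OF K G] show ?thesis by blast
qed

section \<open>Low and high frequencies\<close>

text \<open>For \<open>2 ^ - (k + 1) \<le> norm x < 2 ^ - k\<close> the integrand is at most \<open>4 ^ (k + 1)\<close>.\<close>

lemma integrable_inverse_norm_squared_ball:
  assumes n: "DIM('a::euclidean_space) \<ge> 3"
  shows "integrable lebesgue (\<lambda>x::'a. indicator (ball 0 1) x / (norm x)\<^sup>2 :: real)"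
proof -
  let ?f = "\<lambda>x::'a. indicator (ball 0 1) x / (norm x)\<^sup>2 :: real"
  let ?B = "\<lambda>k::nat. ball (0::'a) ((1/2) ^ k)"
  let ?V = "unit_ball_vol (real DIM('a))"
  have [measurable]: "?f \<in> borel_measurable borel"
    by (intro borel_measurable_divide borel_measurable_indicator borel_measurable_power borel_measurable_norm) auto
  have suminf_ge: "h k \<le> suminf h" for h :: "nat \<Rightarrow> ennreal" and k
    using sum_le_suminf[OF summableI, of "{k}" h] by simp
  have le: "ennreal (?f x) \<le> (\<Sum>k. 4 ^ Suc k * indicator (?B k) x)" for x
  \<comment> \<open>Outside this case the integrand is 0: at the origin because division by zero
    yields 0, elsewhere because the indicator vanishes.\<close>
  proof (cases "x \<noteq> 0 \<and> norm x < 1")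
    case True
    then obtain k0 where "(1/2::real) ^ k0 < norm x"
      using real_arch_pow_inv[of "norm x" "1/2"] by auto
    then have "(1/2::real) ^ Suc k0 \<le> norm x"
      using power_decreasing[of k0 "Suc k0" "1/2::real"] by linarith
    \<comment> \<open>The least such k locates the dyadic shell: minimality gives the upper bound on
      the norm, and for k = 0 it is the assumption that the norm is below 1.\<close>
    then obtain k where k: "(1/2::real) ^ Suc k \<le> norm x" and least: "\<And>j. j < k \<Longrightarrow> \<not> (1/2::real) ^ Suc j \<le> norm x"
      using exists_least_iff[of "\<lambda>k. (1/2::real) ^ Suc k \<le> norm x"] by blast
    have "norm x < (1/2) ^ k"
      using True least[of "k - 1"] by (cases k) auto
    then have ind: "indicator (?B k) x = (1::ennreal)" by simp
    have "1 / (norm x)\<^sup>2 \<le> 1 / ((1/2) ^ Suc k)\<^sup>2"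
      using k True by (intro divide_left_mono power_mono) auto
    also have "\<dots> = 4 ^ Suc k"
      by (simp add: power_divide power2_eq_square flip: power_mult_distrib)
    finally have "ennreal (?f x) \<le> ennreal (4 ^ Suc k)"
      using True by (intro ennreal_leI) simp
    also have "\<dots> = 4 ^ Suc k * indicator (?B k) x"
      unfolding ind by (simp add: ennreal_power[symmetric] ennreal_mult)
    also have "\<dots> \<le> (\<Sum>k. 4 ^ Suc k * indicator (?B k) x)"
      by (rule suminf_ge)
    finally show ?thesis .
  qed auto
  \<comment> \<open>The dimension enters here: the k-th ball has volume at most \<open>?V\<close>
    times 8^(-k), which outweighs the factor 4^(k+1) and leaves a geometric series of ratio
    1/2.\<close>
  have term_le: "4 ^ Suc k * emeasure lborel (?B k) \<le> ennreal (4 * ?V * (1/2) ^ k)" for k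
  proof -
    have "((1/2::real) ^ k) ^ DIM('a) \<le> ((1/2) ^ k) ^ 3"
      using n by (intro power_decreasing power_le_one) auto
    also have "\<dots> = ((1/2) ^ 3) ^ k"
      by (simp only: power_mult[symmetric] mult.commute)
    also have "\<dots> = (1/8) ^ k"
      by (simp add: power_divide)
    finally have "((1/2::real) ^ k) ^ DIM('a) \<le> (1/8) ^ k" .
    then have "4 ^ Suc k * (?V * ((1/2) ^ k) ^ DIM('a)) \<le> 4 ^ Suc k * (?V * (1/8) ^ k)"
      by (intro mult_left_mono) auto
    also have "\<dots> = 4 * ?V * ((4 * (1/8)) ^ k)"
      unfolding power_mult_distrib by simp
    finally have "4 ^ Suc k * (?V * ((1/2) ^ k) ^ DIM('a)) \<le> 4 * ?V * (1/2) ^ k" by simp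
    moreover have "4 ^ Suc k * emeasure lborel (?B k) = ennreal (4 ^ Suc k * (?V * ((1/2) ^ k) ^ DIM('a)))"
      by (subst emeasure_ball) (simp_all add: ennreal_mult ennreal_power[symmetric])
    ultimately show ?thesis by (simp add: ennreal_leI)
  qed
  have "(\<integral>\<^sup>+x. ennreal (?f x) \<partial>lborel) \<le> (\<integral>\<^sup>+x. (\<Sum>k. 4 ^ Suc k * indicator (?B k) x) \<partial>lborel)"
    by (intro nn_integral_mono le)
  also have "\<dots> = (\<Sum>k. \<integral>\<^sup>+x. 4 ^ Suc k * indicator (?B k) x \<partial>lborel)"
    by (intro nn_integral_suminf borel_measurable_times_ennreal borel_measurable_const borel_measurable_indicator) simp
  also have "\<dots> = (\<Sum>k. 4 ^ Suc k * emeasure lborel (?B k))"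
    by (intro suminf_cong nn_integral_cmult_indicator) simp
  also have "\<dots> \<le> (\<Sum>k. ennreal (4 * ?V * (1/2) ^ k))"
    by (intro suminf_le summableI term_le)
  also have "\<dots> = ennreal (\<Sum>k. 4 * ?V * (1/2) ^ k)"
    by (rule suminf_ennreal2) (auto intro!: summable_mult summable_geometric)
  also have "\<dots> < \<infinity>" by simp
  finally have "integrable lborel ?f"
    by (intro integrableI_nonneg) auto
  then show ?thesis
    by (simp add: integrable_completion)
qed

section \<open>Size of the symbol\<close>

lemma symbol_measurable [measurable]: "symbol \<delta> \<theta> \<mu> \<kappa> \<in> borel_measurable borel"
  unfolding symbol_def[abs_def] by measurable

text \<open>At low frequency the term \<open>\<kappa> * r\<^sup>2\<close> is the one retained below;
  since \<theta> is nonnegative, the denominator of the symbol is at most 1 + \<delta>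
  there.\<close>

lemma symbol_low_frequency:
  assumes "\<delta> > 0" "0 \<le> \<theta>" "\<mu> > 0" "\<kappa> > 0" "0 < r" "r \<le> 1"
  shows "1 / (symbol \<delta> \<theta> \<mu> \<kappa> r)\<^sup>2 \<le> (1 + \<delta>) / \<kappa> * (1 / r\<^sup>2)"
proof -
  have "r powr (2 * \<theta>) \<le> 1 powr (2 * \<theta>)"
    using assms by (intro powr_mono2) auto
  then have "1 + \<delta> * r powr (2 * \<theta>) \<le> 1 + \<delta> * 1"
    using assms by (intro add_left_mono mult_left_mono) auto
  moreover have "\<mu> * r ^ 4 + \<kappa> * r\<^sup>2 \<ge> \<kappa> * r\<^sup>2"
    using assms by simp
  ultimately have "(1 + \<delta> * r powr (2 * \<theta>)) / (\<mu> * r ^ 4 + \<kappa> * r\<^sup>2) \<le> (1 + \<delta>) / (\<kappa> * r\<^sup>2)"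
    using assms by (intro frac_le) auto
  moreover have "(symbol \<delta> \<theta> \<mu> \<kappa> r)\<^sup>2 = (\<mu> * r ^ 4 + \<kappa> * r\<^sup>2) / (1 + \<delta> * r powr (2 * \<theta>))"
    unfolding symbol_def using assms by (intro real_sqrt_pow2 divide_nonneg_nonneg) auto
  ultimately show ?thesis by simp
qed

text \<open>At high frequency the term \<open>\<mu> * r ^ 4\<close> is retained. The condition
  \<theta> \<le> 2 keeps the denominator of the symbol below (1 + \<delta>) r^4, so the fourth
  powers cancel.\<close>

lemma symbol_high_frequency:
  assumes "\<delta> > 0" "\<theta> \<le> 2" "\<mu> > 0" "\<kappa> > 0" "1 \<le> r"
  shows "1 / (symbol \<delta> \<theta> \<mu> \<kappa> r)\<^sup>2 \<le> (1 + \<delta>) / \<mu>"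
proof -
  have "r powr (2 * \<theta>) \<le> r powr 4"
    using assms by (intro powr_mono) auto
  also have "\<dots> = r ^ 4"
    using assms powr_realpow[of r 4] by simp
  finally have "1 + \<delta> * r powr (2 * \<theta>) \<le> r ^ 4 + \<delta> * r ^ 4"
    using assms one_le_power[of r 4] by (intro add_mono mult_left_mono) auto
  moreover have "\<mu> * r ^ 4 + \<kappa> * r\<^sup>2 \<ge> \<mu> * r ^ 4"
    using assms by simp
  ultimately have "(1 + \<delta> * r powr (2 * \<theta>)) / (\<mu> * r ^ 4 + \<kappa> * r\<^sup>2) \<le> (r ^ 4 + \<delta> * r ^ 4) / (\<mu> * r ^ 4)"
    using assms by (intro frac_le add_nonneg_nonneg mult_nonneg_nonneg) auto
  also have "\<dots> = (1 + \<delta>) / \<mu>"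
    using assms by (simp add: field_simps)
  finally have "(1 + \<delta> * r powr (2 * \<theta>)) / (\<mu> * r ^ 4 + \<kappa> * r\<^sup>2) \<le> (1 + \<delta>) / \<mu>" .
  moreover have "(symbol \<delta> \<theta> \<mu> \<kappa> r)\<^sup>2 = (\<mu> * r ^ 4 + \<kappa> * r\<^sup>2) / (1 + \<delta> * r powr (2 * \<theta>))"
    unfolding symbol_def using assms by (intro real_sqrt_pow2 divide_nonneg_nonneg) auto
  ultimately show ?thesis by simp
qed

text \<open>The two regimes are added rather than separated by cases, so that one integrated
  inequality later covers all frequencies and splits by linearity.\<close>

lemma sine_quotient_bound:
  fixes \<xi> :: "'a::real_normed_vector"
  assumes "\<delta> > 0" "0 \<le> \<theta>" "\<theta> \<le> 2" "\<mu> > 0" "\<kappa> > 0"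
  shows "(sin (t * symbol \<delta> \<theta> \<mu> \<kappa> (norm \<xi>)) / symbol \<delta> \<theta> \<mu> \<kappa> (norm \<xi>))\<^sup>2
    \<le> (1 + \<delta>) / \<kappa> * (indicator (ball 0 1) \<xi> / (norm \<xi>)\<^sup>2) + (1 + \<delta>) / \<mu>"
\<comment> \<open>At the origin the symbol is 0 and both quotients by zero evaluate to 0.\<close>
proof (cases "\<xi> = 0")
  case True
  then show ?thesis using assms by (simp add: symbol_def)
next
  case False
  let ?f = "symbol \<delta> \<theta> \<mu> \<kappa> (norm \<xi>)"
  have "\<bar>sin (t * ?f)\<bar>\<^sup>2 \<le> 1\<^sup>2"
    by (intro power_mono) auto
  then have "(sin (t * ?f) / ?f)\<^sup>2 \<le> 1 / ?f\<^sup>2"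
    by (simp add: power_divide divide_right_mono)
  also have "\<dots> \<le> (1 + \<delta>) / \<kappa> * (indicator (ball 0 1) \<xi> / (norm \<xi>)\<^sup>2) + (1 + \<delta>) / \<mu>"
  proof (cases "norm \<xi> < 1")
    case True
    then have "1 / ?f\<^sup>2 \<le> (1 + \<delta>) / \<kappa> * (1 / (norm \<xi>)\<^sup>2)"
      using assms False by (intro symbol_low_frequency) auto
    also have "\<dots> \<le> (1 + \<delta>) / \<kappa> * (1 / (norm \<xi>)\<^sup>2) + (1 + \<delta>) / \<mu>"
      using assms by simp
    finally show ?thesis using True by simp
  next
    case *: False
    then show ?thesis using symbol_high_frequency[of \<delta> \<theta> \<mu> \<kappa> "norm \<xi>"] assms by simp
  qed
  finally show ?thesis .
qed

section \<open>The chosen transforms and the energy bound\<close>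

lemma has_fourier_transform_fourier:
  "g \<in> L2 lebesgue \<Longrightarrow> has_fourier_transform g (fourier g)"
  unfolding fourier_def by (rule someI_ex[OF has_fourier_transform_exists])

lemma has_fourier_transform_inv_fourier:
  "G \<in> L2 lebesgue \<Longrightarrow> has_fourier_transform (inv_fourier G) G"
  unfolding inv_fourier_def by (rule someI_ex[OF has_fourier_transform_surj])

lemma Plancherel:
  fixes g :: "real ^ 'n \<Rightarrow> complex"
  assumes "has_fourier_transform g G"
  shows "(L2_norm lebesgue g)\<^sup>2 = (L2_norm freq_measure G)\<^sup>2"
proof -
  have "G \<in> borel_measurable lebesgue"
    using assms by (auto simp: has_fourier_transform_iff intro: L2_measurable)
  then show ?thesis
    by (simp add: L2_norm_freq has_fourier_transform_isometry[OF assms] power_mult_distrib)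
qed

text \<open>\<open>fourier g\<close> is only some representative of the transform, so the bound by
  the L1 norm passes to it almost everywhere, by uniqueness.\<close>

lemma fourier_bound_AE:
  fixes g :: "real ^ 'n \<Rightarrow> complex"
  assumes g: "g \<in> L1 lebesgue" "g \<in> L2 lebesgue"
  shows "AE \<xi> in lebesgue. cmod (fourier g \<xi>) \<le> L1_norm lebesgue g"
  using has_fourier_transform_unique[OF has_fourier_transform_fourier[OF g(2)]
      has_fourier_transform_fourier_integral[OF g]]
  by eventually_elim (simp add: fourier_integral_bound)

text \<open>The first conjunct certifies that the choice hidden in \<open>solution\<close> is a
  genuine preimage, so that the norm identity speaks about the intended function.\<close>

theorem proposition4p1:
  fixes \<delta> \<theta> \<mu> \<kappa> :: real
  assumes "CARD('n::finite) \<ge> 3"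
    and "\<delta> > 0" and "0 \<le> \<theta>" and "\<theta> \<le> 2" and "\<mu> > 0" and "\<kappa> > 0"
  shows "\<exists>C>0. \<forall>u0 u1 :: real ^ 'n \<Rightarrow> complex.
    u0 \<in> L2 lebesgue \<longrightarrow> u1 \<in> L1 lebesgue \<inter> L2 lebesgue \<longrightarrow>
    (\<forall>\<^sub>F t in at_top.
       has_fourier_transform (solution \<delta> \<theta> \<mu> \<kappa> u0 u1 t) (solution_hat \<delta> \<theta> \<mu> \<kappa> u0 u1 t) \<and>
       (L2_norm lebesgue (solution \<delta> \<theta> \<mu> \<kappa> u0 u1 t))\<^sup>2
         = (L2_norm freq_measure (solution_hat \<delta> \<theta> \<mu> \<kappa> u0 u1 t))\<^sup>2 \<and>
       (L2_norm freq_measure (solution_hat \<delta> \<theta> \<mu> \<kappa> u0 u1 t))\<^sup>2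
         \<le> C * ((L2_norm lebesgue u0)\<^sup>2 + (L2_norm lebesgue u1)\<^sup>2 + (L1_norm lebesgue u1)\<^sup>2))"
proof -
  define A where "A = (1 + \<delta>) / \<kappa>"
  define B where "B = (1 + \<delta>) / \<mu>"
  define p :: real where "p = (2 * pi) ^ CARD('n)"
  define J where "J = (LINT \<xi>::real^'n|lebesgue. indicator (ball 0 1) \<xi> / (norm \<xi>)\<^sup>2 :: real)"
  \<comment> \<open>C is the sum of the coefficients 2, 2 B and 2 A J / p that the three squared
    norms receive below, so it dominates each. The 2 comes from (a + b)^2 \<le> 2 a^2 + 2 b^2, and 1
    / p from \<open>freq_measure\<close>; in the term with B the latter cancels against the isometry
    factor.\<close>
  define C where "C = 2 * (1 + B + A * J / p)"
  have pos: "A > 0" "B > 0" "p > 0" "J \<ge> 0"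
    using assms by (auto simp: A_def B_def p_def J_def)
  then have "C \<ge> 2"
    by (simp add: C_def)
  let ?f = "\<lambda>\<xi>::real^'n. symbol \<delta> \<theta> \<mu> \<kappa> (norm \<xi>)"
  have J_int: "integrable lebesgue (\<lambda>\<xi>::real^'n. indicator (ball 0 1) \<xi> / (norm \<xi>)\<^sup>2 :: real)"
    using assms by (intro integrable_inverse_norm_squared_ball) simp
  have main: "has_fourier_transform (solution \<delta> \<theta> \<mu> \<kappa> u0 u1 t) (solution_hat \<delta> \<theta> \<mu> \<kappa> u0 u1 t) \<and>
       (L2_norm lebesgue (solution \<delta> \<theta> \<mu> \<kappa> u0 u1 t))\<^sup>2
         = (L2_norm freq_measure (solution_hat \<delta> \<theta> \<mu> \<kappa> u0 u1 t))\<^sup>2 \<and>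
       (L2_norm freq_measure (solution_hat \<delta> \<theta> \<mu> \<kappa> u0 u1 t))\<^sup>2
         \<le> C * ((L2_norm lebesgue u0)\<^sup>2 + (L2_norm lebesgue u1)\<^sup>2 + (L1_norm lebesgue u1)\<^sup>2)"
    if u0: "u0 \<in> L2 lebesgue" and u1: "u1 \<in> L1 lebesgue" "u1 \<in> L2 lebesgue"
    for u0 u1 :: "real ^ 'n \<Rightarrow> complex" and t
  proof -
    let ?w = "solution_hat \<delta> \<theta> \<mu> \<kappa> u0 u1 t"
    define w0 where "w0 \<xi> = complex_of_real (cos (t * ?f \<xi>)) * fourier u0 \<xi>" for \<xi>
    define w1 where "w1 \<xi> = complex_of_real (sin (t * ?f \<xi>) / ?f \<xi>) * fourier u1 \<xi>" for \<xi>
    have w_eq: "?w = (\<lambda>\<xi>. w0 \<xi> + w1 \<xi>)"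
      by (simp add: fun_eq_iff solution_hat_def w0_def w1_def Let_def)
    note ft0 = has_fourier_transform_fourier[OF u0] and ft1 = has_fourier_transform_fourier[OF u1(2)]
    have F: "fourier u0 \<in> L2 lebesgue" "fourier u1 \<in> L2 lebesgue"
      using ft0 ft1 by (auto simp: has_fourier_transform_iff)
    note [measurable] = F[THEN L2_measurable]
    have f_meas [measurable]: "?f \<in> borel_measurable lebesgue"
      by (rule borel_measurable_imp_lebesgue) measurable
    have w0_meas: "w0 \<in> borel_measurable lebesgue" and w1_meas: "w1 \<in> borel_measurable lebesgue"
      unfolding w0_def[abs_def] w1_def[abs_def] by measurable
    have w0_le: "AE \<xi> in lebesgue. cmod (w0 \<xi>) \<le> cmod (fourier u0 \<xi>)"
      by (intro AE_I2) (simp add: w0_def norm_mult mult_left_le_one_le)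
    have w0: "w0 \<in> L2 lebesgue"
      using L2_bounded[OF F(1) w0_meas, of 1] w0_le by simp
    \<comment> \<open>This bound depends on t and serves only to place \<open>w1\<close> in L2; the
      estimate uniform in t is made separately.\<close>
    have sin_le: "\<bar>sin (t * s) / s\<bar> \<le> \<bar>t\<bar>" for s
      using abs_sin_x_le_abs_x[of "t * s"] by (cases "s = 0") (simp_all add: abs_mult pos_divide_le_eq)
    have w1: "w1 \<in> L2 lebesgue"
      by (intro L2_bounded[OF F(2) w1_meas, of "\<bar>t\<bar>"] AE_I2)
        (unfold w1_def norm_mult norm_of_real, intro mult_right_mono sin_le norm_ge_zero)
    have w: "?w \<in> L2 lebesgue"
      unfolding w_eq by (rule L2_add[OF w0 w1])
    have ft: "has_fourier_transform (solution \<delta> \<theta> \<mu> \<kappa> u0 u1 t) ?w"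
      unfolding solution_def by (rule has_fourier_transform_inv_fourier[OF w])
    have nF: "(L2_norm lebesgue (fourier u0))\<^sup>2 = p * (L2_norm lebesgue u0)\<^sup>2"
      "(L2_norm lebesgue (fourier u1))\<^sup>2 = p * (L2_norm lebesgue u1)\<^sup>2"
      using pos by (simp_all add: has_fourier_transform_isometry[OF ft0, folded p_def]
          has_fourier_transform_isometry[OF ft1, folded p_def] power_mult_distrib)
    have n0: "(L2_norm lebesgue w0)\<^sup>2 \<le> p * (L2_norm lebesgue u0)\<^sup>2"
      unfolding nF[symmetric] by (intro power_mono L2_norm_mono[OF F(1) w0_meas w0_le]) simp
    have "(L2_norm lebesgue w1)\<^sup>2 \<le> (LINT \<xi>|lebesgue. A * (L1_norm lebesgue u1)\<^sup>2 * (indicator (ball 0 1) \<xi> / (norm \<xi>)\<^sup>2)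
        + B * (cmod (fourier u1 \<xi>))\<^sup>2)"
      unfolding L2_norm_power2
    proof (rule integral_mono_AE)
      show "AE \<xi> in lebesgue. (cmod (w1 \<xi>))\<^sup>2 \<le>
          A * (L1_norm lebesgue u1)\<^sup>2 * (indicator (ball 0 1) \<xi> / (norm \<xi>)\<^sup>2) + B * (cmod (fourier u1 \<xi>))\<^sup>2"
        using fourier_bound_AE[OF u1]
      proof eventually_elim
        case (elim \<xi>)
        let ?i = "indicator (ball 0 1) \<xi> / (norm \<xi>)\<^sup>2 :: real"
        have "(cmod (w1 \<xi>))\<^sup>2 = (sin (t * ?f \<xi>) / ?f \<xi>)\<^sup>2 * (cmod (fourier u1 \<xi>))\<^sup>2"
          unfolding w1_def norm_mult norm_of_real power_mult_distrib power2_abs ..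
        also have "\<dots> \<le> (A * ?i + B) * (cmod (fourier u1 \<xi>))\<^sup>2"
          unfolding A_def B_def using assms by (intro mult_right_mono sine_quotient_bound) auto
        also have "\<dots> = A * ?i * (cmod (fourier u1 \<xi>))\<^sup>2 + B * (cmod (fourier u1 \<xi>))\<^sup>2"
          by (rule distrib_right)
        \<comment> \<open>Only the singular low-frequency part trades the transform of
          \<open>u1\<close> for the L1 norm; the other part keeps it, to be integrated by the
          isometry.\<close>
        also have "\<dots> \<le> A * ?i * (L1_norm lebesgue u1)\<^sup>2 + B * (cmod (fourier u1 \<xi>))\<^sup>2"
          using elim pos by (intro add_right_mono mult_left_mono power_mono) auto
        finally show ?case by (simp add: mult_ac)
      qed
    qed (intro Bochner_Integration.integrable_add integrable_mult_right J_int L2_integrable F w1)+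
    also have "\<dots> = A * (L1_norm lebesgue u1)\<^sup>2 * J + B * (p * (L2_norm lebesgue u1)\<^sup>2)"
      unfolding J_def nF(2)[symmetric] unfolding L2_norm_power2
      by (subst Bochner_Integration.integral_add)
        (intro integrable_mult_right J_int L2_integrable F | simp only: integral_mult_right_zero)+
    finally have n1: "(L2_norm lebesgue w1)\<^sup>2 \<le> A * (L1_norm lebesgue u1)\<^sup>2 * J + B * (p * (L2_norm lebesgue u1)\<^sup>2)" .
    have "(L2_norm lebesgue ?w)\<^sup>2 \<le> (L2_norm lebesgue w0 + L2_norm lebesgue w1)\<^sup>2"
      unfolding w_eq by (intro power_mono L2_norm_triangle w0 w1) simp
    also have "\<dots> \<le> 2 * (L2_norm lebesgue w0)\<^sup>2 + 2 * (L2_norm lebesgue w1)\<^sup>2"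
      using sum_squares_bound[of "L2_norm lebesgue w0" "L2_norm lebesgue w1"] by (simp add: power2_sum)
    finally have "(L2_norm freq_measure ?w)\<^sup>2 \<le> (2 * (p * (L2_norm lebesgue u0)\<^sup>2)
        + 2 * (A * (L1_norm lebesgue u1)\<^sup>2 * J + B * (p * (L2_norm lebesgue u1)\<^sup>2))) / p"
      unfolding L2_norm_freq[OF L2_measurable[OF w], folded p_def]
      using n0 n1 pos by (intro divide_right_mono) auto
    also have "\<dots> = 2 * (L2_norm lebesgue u0)\<^sup>2 + 2 * B * (L2_norm lebesgue u1)\<^sup>2 + 2 * (A * J / p) * (L1_norm lebesgue u1)\<^sup>2"
      using pos by (simp add: field_simps)
    also have "\<dots> \<le> C * (L2_norm lebesgue u0)\<^sup>2 + C * (L2_norm lebesgue u1)\<^sup>2 + C * (L1_norm lebesgue u1)\<^sup>2"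
      using pos by (intro add_mono mult_right_mono) (auto simp: C_def)
    finally show ?thesis
      using ft Plancherel[OF ft] by (simp add: distrib_left)
  qed
  show ?thesis
    using \<open>C \<ge> 2\<close> by (intro exI[of _ C] conjI allI impI always_eventually main) auto
qed

end
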